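(* Let $G$ be an SE-graph with sources $r_1,\dots,r_m$ and sinks $c_1,\dots,c_n$, and let $\mathrm{Path}_G$ be its path matrix. Then for every $(I|J)\in\mathcal E^{m,n}$, $$[I|J]_{\mathrm{Path}_G,q}=\sum_{\phi\in\Phi(I|J)} w(\phi),$$ where $\Phi(I|J)$ is the set of $(I|J)$-flows in $G$.
   Context: Notation: $[p]=\{1,\dots,p\}$; $\mathcal E^{m,n}$ is the set of pairs $(I|J)$ with $I\subseteq[m]$, $J\subseteq[n]$, $|I|=|J|$. Fix a field $\mathbb K$ and $q\in\mathbb K^\ast$. An SE-graph is a finite directed graph $G=(V,E)$ embedded in the plane (planar with a fixed layout) such that: every edge is either a horizontal edge (H-edge) directed to the right or a vertical edge (V-edge) directed downward; there are distinguished vertices $r_1,\dots,r_m$ (sources) lying on a vertical line in this order upward, and $c_1,\dots,c_n$ (sinks) lying on a horizontal line in this order from left to right; sources are incident only with H-edges and sinks only with V-edges; every vertex lies on a directed path from a source to a sink. Let $W$ be the set of inner vertices (neither sources nor sinks). $\mathcal L_G$ is the $\mathbb K$-algebra of Laurent polynomials in the elements of $W$ with relations, for distinct $u,v\in W$: $uv=qvu$ if $G$ has a directed horizontal path from $u$ to $v$; $vu=quv$ if $G$ has a directed vertical path from $u$ to $v$; $uv=vu$ otherwise. Edge weights: $w(e)=v$ if $e=(u,v)$ with $u$ a source; $w(e)=u^{-1}v$ if $e=(u,v)$ is an H-edge with $u,v\in W$; $w(e)=1$ for V-edges. The weight of a directed path $e_1\cdots e_k$ is $w(e_1)\cdots w(e_k)$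 (ordered product). $\mathrm{Path}_G$ is the $m\times n$ matrix whose $(i,j)$ entry is the sum of weights of directed paths from $r_i$ to $c_j$. For $(I|J)\in\mathcal E^{m,n}$, an $(I|J)$-flow is a set of pairwise vertex-disjoint directed paths from the sources $\{r_i:i\in I\}$ to the sinks $\{c_j:j\in J\}$ (one path starting at each such source). Writing $I=\{i_1<\dots<i_k\}$, $J=\{j_1<\dots<j_k\}$, the $\ell$-th path $P_\ell$ of the flow starts at $r_{i_\ell}$ (and ends at $c_{j_\ell}$), and the weight of the flow $\phi=(P_1,\dots,P_k)$ is the ordered product $w(\phi)=w(P_1)\cdots w(P_k)$. The $q$-minor of a matrix $A=(a_{ij})$ is $[I|J]_{A,q}=\sum_{\sigma\in S_k}(-q)^{\ell(\sigma)}a_{i_1j_{\sigma(1)}}\cdots a_{i_kj_{\sigma(k)}}$ (product ordered left to right), with $\ell(\sigma)$ the number of inversions. *)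

theory Defs
  imports "HOL-Analysis.Analysis" "HOL-Combinatorics.Permutations"
begin

type_synonym point = "real \<times> real"

definition is_H :: "('v \<Rightarrow> point) \<Rightarrow> 'v \<Rightarrow> 'v \<Rightarrow> bool" where
  "is_H pos u v \<longleftrightarrow> snd (pos u) = snd (pos v) \<and> fst (pos u) < fst (pos v)"

definition is_V :: "('v \<Rightarrow> point) \<Rightarrow> 'v \<Rightarrow> 'v \<Rightarrow> bool" where
  "is_V pos u v \<longleftrightarrow> fst (pos u) = fst (pos v) \<and> snd (pos v) < snd (pos u)"

definition edge_seg :: "('v \<Rightarrow> point) \<Rightarrow> 'v \<times> 'v \<Rightarrow> point set" where
  "edge_seg pos e = closed_segment (pos (fst e)) (pos (snd e))"

definition is_path :: "('v \<times> 'v) set \<Rightarrow> 'v list \<Rightarrow> 'v \<Rightarrow> 'v \<Rightarrow> bool" where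
  "is_path E p u v \<longleftrightarrow> p \<noteq> [] \<and> hd p = u \<and> last p = v \<and>
     (\<forall>k < length p - 1. (p ! k, p ! Suc k) \<in> E)"

definition hpath :: "('v \<times> 'v) set \<Rightarrow> ('v \<Rightarrow> point) \<Rightarrow> 'v \<Rightarrow> 'v \<Rightarrow> bool" where
  "hpath E pos u v \<longleftrightarrow> (\<exists>p. is_path E p u v \<and> length p \<ge> 2 \<and>
     (\<forall>k < length p - 1. is_H pos (p ! k) (p ! Suc k)))"

definition vpath :: "('v \<times> 'v) set \<Rightarrow> ('v \<Rightarrow> point) \<Rightarrow> 'v \<Rightarrow> 'v \<Rightarrow> bool" where
  "vpath E pos u v \<longleftrightarrow> (\<exists>p. is_path E p u v \<and> length p \<ge> 2 \<and>
     (\<forall>k < length p - 1. is_V pos (p ! k) (p ! Suc k)))"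

definition se_graph ::
  "'v set \<Rightarrow> ('v \<times> 'v) set \<Rightarrow> ('v \<Rightarrow> point) \<Rightarrow> nat \<Rightarrow> nat \<Rightarrow> (nat \<Rightarrow> 'v) \<Rightarrow> (nat \<Rightarrow> 'v) \<Rightarrow> bool"
where
  "se_graph V E pos m n r c \<longleftrightarrow>
     finite V \<and> E \<subseteq> V \<times> V \<and> inj_on pos V \<and>
     \<comment> \<open>every edge is an H-edge (to the right) or a V-edge (downward)\<close>
     (\<forall>(u,v)\<in>E. is_H pos u v \<or> is_V pos u v) \<and>
     \<comment> \<open>planarity of the straight-line embedding\<close>
     (\<forall>e\<in>E. \<forall>e'\<in>E. e \<noteq> e' \<longrightarrow>
        edge_seg pos e \<inter> edge_seg pos e' \<subseteq> pos ` ({fst e, snd e} \<inter> {fst e', snd e'})) \<and>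
     (\<forall>w\<in>V. \<forall>e\<in>E. pos w \<in> edge_seg pos e \<longrightarrow> w = fst e \<or> w = snd e) \<and>
     \<comment> \<open>sources and sinks\<close>
     r ` {1..m} \<subseteq> V \<and> c ` {1..n} \<subseteq> V \<and>
     inj_on r {1..m} \<and> inj_on c {1..n} \<and> r ` {1..m} \<inter> c ` {1..n} = {} \<and>
     (\<forall>i\<in>{1..m}. \<forall>i'\<in>{1..m}. fst (pos (r i)) = fst (pos (r i'))) \<and>
     (\<forall>i\<in>{1..m}. \<forall>i'\<in>{1..m}. i < i' \<longrightarrow> snd (pos (r i)) < snd (pos (r i'))) \<and>
     (\<forall>j\<in>{1..n}. \<forall>j'\<in>{1..n}. snd (pos (c j)) = snd (pos (c j'))) \<and>
     (\<forall>j\<in>{1..n}. \<forall>j'\<in>{1..n}. j < j' \<longrightarrow> fst (pos (c j)) < fst (pos (c j'))) \<and>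
     (\<forall>(u,v)\<in>E. (u \<in> r ` {1..m} \<or> v \<in> r ` {1..m}) \<longrightarrow> is_H pos u v) \<and>
     (\<forall>(u,v)\<in>E. (u \<in> c ` {1..n} \<or> v \<in> c ` {1..n}) \<longrightarrow> is_V pos u v) \<and>
     \<comment> \<open>every vertex lies on a directed path from a source to a sink\<close>
     (\<forall>w\<in>V. \<exists>i\<in>{1..m}. \<exists>j\<in>{1..n}. \<exists>p. is_path E p (r i) (c j) \<and> w \<in> set p)"

definition inner_vertices ::
  "'v set \<Rightarrow> nat \<Rightarrow> nat \<Rightarrow> (nat \<Rightarrow> 'v) \<Rightarrow> (nat \<Rightarrow> 'v) \<Rightarrow> 'v set" where
  "inner_vertices V m n r c = V - r ` {1..m} - c ` {1..n}"

section \<open>Weights (in a K-algebra, images x w of the generators w of L_G, inverses xinv w)\<close>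

definition edge_weight ::
  "('v \<Rightarrow> point) \<Rightarrow> nat \<Rightarrow> (nat \<Rightarrow> 'v) \<Rightarrow> ('v \<Rightarrow> 'a::ring_1) \<Rightarrow> ('v \<Rightarrow> 'a) \<Rightarrow> 'v \<Rightarrow> 'v \<Rightarrow> 'a" where
  "edge_weight pos m r x xinv u v =
     (if u \<in> r ` {1..m} then x v
      else if is_H pos u v then xinv u * x v
      else 1)"

definition path_weight ::
  "('v \<Rightarrow> point) \<Rightarrow> nat \<Rightarrow> (nat \<Rightarrow> 'v) \<Rightarrow> ('v \<Rightarrow> 'a::ring_1) \<Rightarrow> ('v \<Rightarrow> 'a) \<Rightarrow> 'v list \<Rightarrow> 'a" where
  "path_weight pos m r x xinv p =
     prod_list (map (\<lambda>k. edge_weight pos m r x xinv (p ! k) (p ! Suc k)) [0..<length p - 1])"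

definition path_matrix ::
  "('v \<times> 'v) set \<Rightarrow> ('v \<Rightarrow> point) \<Rightarrow> nat \<Rightarrow> (nat \<Rightarrow> 'v) \<Rightarrow> (nat \<Rightarrow> 'v) \<Rightarrow>
   ('v \<Rightarrow> 'a::ring_1) \<Rightarrow> ('v \<Rightarrow> 'a) \<Rightarrow> nat \<Rightarrow> nat \<Rightarrow> 'a" where
  "path_matrix E pos m r c x xinv i j =
     (\<Sum>p\<in>{p. is_path E p (r i) (c j)}. path_weight pos m r x xinv p)"

definition inversions :: "(nat \<Rightarrow> nat) \<Rightarrow> nat \<Rightarrow> nat" where
  "inversions \<sigma> k = card {(a, b). a < b \<and> b < k \<and> \<sigma> b < \<sigma> a}"

text \<open>q-minor [I|J] of A (rows/columns indexed by naturals); emb is the structure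
  map of the K-algebra.\<close>
definition qminor ::
  "('k::field \<Rightarrow> 'a::ring_1) \<Rightarrow> 'k \<Rightarrow> (nat \<Rightarrow> nat \<Rightarrow> 'a) \<Rightarrow> nat set \<Rightarrow> nat set \<Rightarrow> 'a" where
  "qminor emb q A I J =
     (let il = sorted_list_of_set I; jl = sorted_list_of_set J; k = card I in
      \<Sum>\<sigma>\<in>{\<sigma>. \<sigma> permutes {..<k}}.
        emb ((- q) ^ inversions \<sigma> k) * prod_list (map (\<lambda>t. A (il ! t) (jl ! \<sigma> t)) [0..<k]))"

definition flows ::
  "('v \<times> 'v) set \<Rightarrow> (nat \<Rightarrow> 'v) \<Rightarrow> (nat \<Rightarrow> 'v) \<Rightarrow> nat set \<Rightarrow> nat set \<Rightarrow> 'v list list set" where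
  "flows E r c I J =
     {P. length P = card I \<and>
         (\<forall>l < card I. \<exists>j\<in>J. is_path E (P ! l) (r (sorted_list_of_set I ! l)) (c j)) \<and>
         (\<forall>l < card I. \<forall>l' < card I. l \<noteq> l' \<longrightarrow> set (P ! l) \<inter> set (P ! l') = {})}"

definition flow_weight ::
  "('v \<Rightarrow> point) \<Rightarrow> nat \<Rightarrow> (nat \<Rightarrow> 'v) \<Rightarrow> ('v \<Rightarrow> 'a::ring_1) \<Rightarrow> ('v \<Rightarrow> 'a) \<Rightarrow> 'v list list \<Rightarrow> 'a" where
  "flow_weight pos m r x xinv P = prod_list (map (path_weight pos m r x xinv) P)"

end

theory Submission
  imports Defs
begin

text \<open>
  Expanding the minor gives a signed sum over all systems of paths; the systems whose paths meet
  cancel in pairs. Let \<open>v\<close> be a shared vertex with \<open>x - y\<close> maximal. Exactly two paths pass through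
  \<open>v\<close>; one leaves it vertically, the other horizontally, their tails do not meet again, and by
  planarity the vertical tail ends at a sink directly preceding, among the sinks in use, that of
  the horizontal one. Exchanging the tails therefore changes the number of inversions by one, and
  it multiplies the weight by \<open>q\<close> or its inverse.

  The exponent is computed from the skew form describing the commutation of the generators. The tail
  \<open>A\<close> from \<open>v\<close> to a sink \<open>s\<close> pairs with a vertex \<open>w\<close> to \<open>lies_above s w - 2 [w \<in> A]\<close>, up to a term
  depending only on \<open>v\<close> and \<open>w\<close>. In the difference of two tails from \<open>v\<close> that term cancels, and
  summing what is left along a path from a source to a sink gives \<open>0\<close> if the path avoids both tails
  and \<open>1\<close> if it contains the horizontal one.
\<close>

section \<open>Paths and sums along their steps\<close>

lemma is_path_iff_successively:
  "is_path E p u v \<longleftrightarrow> p \<noteq> [] \<and> hd p = u \<and> last p = v \<and> successively (\<lambda>a b. (a, b) \<in> E) p"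
  by (auto simp: is_path_def successively_conv_nth less_diff_conv)

lemma is_path_Nil_iff [simp]: "is_path E [] u v \<longleftrightarrow> False"
  by (simp add: is_path_def)

lemma is_path_singleton_iff [simp]: "is_path E [a] u v \<longleftrightarrow> u = a \<and> v = a"
  by (auto simp: is_path_def)

lemma is_path_Cons_Cons_iff:
  "is_path E (a # b # p) u v \<longleftrightarrow> u = a \<and> (a, b) \<in> E \<and> is_path E (b # p) b v"
  unfolding is_path_iff_successively by auto

lemma is_path_prefix: "is_path E (as @ w # bs) u v \<Longrightarrow> is_path E (as @ [w]) u w"
  and is_path_suffix: "is_path E (as @ w # bs) u v \<Longrightarrow> is_path E (w # bs) w v"
  and is_path_append:
    "is_path E (as @ [w]) u w \<Longrightarrow> is_path E (w # bs) w v \<Longrightarrow> is_path E (as @ w # bs) u v"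
  unfolding is_path_iff_successively by (auto simp: successively_append_iff hd_append)

lemma is_path_endpoints:
  assumes "is_path E p u v"
  shows "u \<in> set p" "v \<in> set p"
  using assms by (auto simp: is_path_def)

lemma trancl_iff_is_path: "(u, v) \<in> R\<^sup>+ \<longleftrightarrow> (\<exists>p. is_path R p u v \<and> 2 \<le> length p)"
proof
  assume "(u, v) \<in> R\<^sup>+"
  then show "\<exists>p. is_path R p u v \<and> 2 \<le> length p"
  proof (induction rule: converse_trancl_induct)
    case (base u)
    then have "is_path R [u, v] u v" by (simp add: is_path_Cons_Cons_iff)
    then show ?case by fastforce
  next
    case (step u w)
    then obtain p where "is_path R (w # p) w v" by (metis is_path_def list.collapse)
    then have "is_path R (u # w # p) u v" using step.hyps by (simp add: is_path_Cons_Cons_iff)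
    then show ?case by fastforce
  qed
next
  assume "\<exists>p. is_path R p u v \<and> 2 \<le> length p"
  then obtain p where "is_path R p u v" "2 \<le> length p" by blast
  then show "(u, v) \<in> R\<^sup>+"
  proof (induction p arbitrary: u rule: induct_list012)
    case (3 a b p)
    then show ?case by (cases p) (auto simp: is_path_Cons_Cons_iff intro: trancl_into_trancl2)
  qed auto
qed

fun step_sum :: "('v \<Rightarrow> 'v \<Rightarrow> bool) \<Rightarrow> ('v \<Rightarrow> 'b::ab_group_add) \<Rightarrow> 'v list \<Rightarrow> 'b" where
  "step_sum S f (u # v # p) = (if S u v then f v - f u else 0) + step_sum S f (v # p)"
| "step_sum S f [u] = 0"
| "step_sum S f [] = 0"

lemma step_sum_append:
  "step_sum S f (as @ v # bs) = step_sum S f (as @ [v]) + step_sum S f (v # bs)"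
proof (induction as)
  case (Cons a as)
  then show ?case by (cases as) (auto simp: add.assoc)
qed auto

lemma step_sum_cong: "(\<And>w. w \<in> set p \<Longrightarrow> f w = g w) \<Longrightarrow> step_sum S f p = step_sum S g p"
  by (induction p rule: induct_list012) auto

lemma step_sum_const: "(\<And>w. w \<in> set p \<Longrightarrow> f w = a) \<Longrightarrow> step_sum S f p = 0"
  by (induction p rule: induct_list012) auto

lemma step_sum_telescope:
  "successively (\<lambda>u v. S u v \<or> f u = f v) p \<Longrightarrow> p \<noteq> [] \<Longrightarrow> step_sum S f p = f (last p) - f (hd p)"
  by (induction p rule: induct_list012) auto

lemma step_sum_add: "step_sum S (\<lambda>w. f w + g w) p = step_sum S f p + step_sum S g p"
  by (induction p rule: induct_list012) auto

lemma step_sum_diff: "step_sum S (\<lambda>w. f w - g w) p = step_sum S f p - step_sum S g p"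
  by (induction p rule: induct_list012) auto

lemma step_sum_uminus: "step_sum S (\<lambda>w. - f w) p = - step_sum S f p"
  by (induction p rule: induct_list012) auto

lemma step_sum_mult: "step_sum S (\<lambda>w. a * f w) p = (a::'b::ring) * step_sum S f p"
  by (induction p rule: induct_list012) (auto simp: algebra_simps)

lemma step_sum_swap:
  "step_sum S (\<lambda>w. step_sum T (\<lambda>u. f u w) p) p' = step_sum T (\<lambda>u. step_sum S (\<lambda>w. f u w) p') p"
  by (induction p' rule: induct_list012) (auto simp: step_sum_add step_sum_diff step_sum_const)

lemma step_sum_antisym:
  fixes f :: "'v \<Rightarrow> 'v \<Rightarrow> int"
  assumes antisym: "\<And>u w. f u w = - f w u"
  shows "step_sum S (\<lambda>w. step_sum S (\<lambda>u. f u w) p) p = 0"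
proof -
  have "step_sum S (\<lambda>w. step_sum S (\<lambda>u. f u w) p) p = step_sum S (\<lambda>w. step_sum S (\<lambda>u. f w u) p) p"
    by (rule step_sum_swap)
  also have "\<dots> = - step_sum S (\<lambda>w. step_sum S (\<lambda>u. f u w) p) p"
    unfolding step_sum_uminus[symmetric] antisym[symmetric] ..
  finally show ?thesis by simp
qed

lemma continuous_on_step_sum:
  fixes f :: "'v \<Rightarrow> 'a::topological_space \<Rightarrow> 'b::real_normed_vector"
  assumes "\<And>w. continuous_on X (f w)"
  shows "continuous_on X (\<lambda>d. step_sum S (\<lambda>w. f w d) p)"
proof (induction p rule: induct_list012)
  case (3 u v p)
  then show ?case by (cases "S u v") (auto intro!: continuous_intros assms)
qed auto

section \<open>Signed reachability\<close>

definition reach_sign :: "('v \<times> 'v) set \<Rightarrow> 'v \<Rightarrow> 'v \<Rightarrow> int" where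
  "reach_sign R u v = of_bool ((u, v) \<in> R\<^sup>+) - of_bool ((v, u) \<in> R\<^sup>+)"

lemma reach_sign_antisym: "reach_sign R u v = - reach_sign R v u"
  by (simp add: reach_sign_def)

lemma trancl_iff_rtrancl_successor:
  assumes "single_valued R" "(u, v) \<in> R"
  shows "(u, w) \<in> R\<^sup>+ \<longleftrightarrow> (v, w) \<in> R\<^sup>*"
  using assms by (metis rtrancl_into_trancl2 single_valuedD tranclD)

lemma trancl_iff_rtrancl_predecessor:
  assumes "single_valued (R\<inverse>)" "(u, v) \<in> R"
  shows "(w, v) \<in> R\<^sup>+ \<longleftrightarrow> (w, u) \<in> R\<^sup>*"
  using trancl_iff_rtrancl_successor[of "R\<inverse>" v u w] assms
  by (simp add: trancl_converse rtrancl_converse)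

lemma reach_sign_step:
  assumes "single_valued R" "single_valued (R\<inverse>)" "acyclic R" "(u, v) \<in> R"
  shows "reach_sign R v w - reach_sign R u w = - of_bool (w = u) - of_bool (w = v)"
  using assms(3) trancl_iff_rtrancl_successor[OF assms(1,4), of w]
    trancl_iff_rtrancl_predecessor[OF assms(2,4), of w]
  by (auto simp: reach_sign_def acyclic_def rtrancl_eq_or_trancl)

section \<open>Commutation up to a power of \<open>q\<close>\<close>

lemma upt_split_at_two:
  assumes "s < t" "t < k"
  shows "[0..<k] = [0..<s] @ s # [Suc s..<t] @ t # [Suc t..<k]"
proof -
  have "[0..<k] = [0..<s] @ [s..<t] @ [t..<k]"
    using assms upt_add_eq_append[of 0 s "k - s"] upt_add_eq_append[of s t "k - t"] by simp
  then show ?thesis using assms by (simp add: upt_conv_Cons)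
qed

locale q_algebra =
  fixes q :: "'k::field" and emb :: "'k \<Rightarrow> 'a::ring_1"
  assumes q_nonzero: "q \<noteq> 0"
    and emb_1: "emb 1 = 1"
    and emb_add: "emb (a + b) = emb a + emb b"
    and emb_mult: "emb (a * b) = emb a * emb b"
    and emb_central: "emb a * z = z * emb a"
begin

definition qcommute :: "int \<Rightarrow> 'a \<Rightarrow> 'a \<Rightarrow> bool" where
  "qcommute e a b \<longleftrightarrow> a * b = emb (q powi e) * (b * a)"

lemma emb_uminus: "emb (- a) = - emb a"
  by (rule Modules.additive.minus) (simp add: Modules.additive_def emb_add)

lemma emb_powi_add: "emb (q powi (e + f)) = emb (q powi e) * emb (q powi f)"
  using q_nonzero by (simp add: power_int_add emb_mult)

lemma emb_left_commute: "z * (emb a * y) = emb a * (z * y)"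
  using emb_central[of a z] by (metis mult.assoc)

lemma qcommute_1_right: "qcommute 0 a 1" and qcommute_1_left: "qcommute 0 1 a"
  and qcommute_refl: "qcommute 0 a a"
  by (auto simp: qcommute_def emb_1)

lemma qcommute_sym:
  assumes "qcommute e a b"
  shows "qcommute (- e) b a"
proof -
  have "emb (q powi (- e)) * (a * b) = emb (q powi (- e + e)) * (b * a)"
    using assms by (simp only: qcommute_def emb_powi_add mult.assoc)
  then show ?thesis by (simp add: qcommute_def emb_1)
qed

lemma qcommute_mult_right:
  assumes "qcommute e a b" "qcommute f a b'"
  shows "qcommute (e + f) a (b * b')"
proof -
  have "a * (b * b') = emb (q powi e) * (b * (a * b'))"
    using assms(1) unfolding qcommute_def by (metis mult.assoc)
  also have "a * b' = emb (q powi f) * (b' * a)"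
    using assms(2) unfolding qcommute_def .
  also have "b * (emb (q powi f) * (b' * a)) = emb (q powi f) * (b * (b' * a))"
    by (rule emb_left_commute)
  finally show ?thesis by (simp add: qcommute_def emb_powi_add mult.assoc)
qed

lemma qcommute_inverse_right:
  assumes "qcommute e a b" "b * b' = 1" "b' * b = 1"
  shows "qcommute (- e) a b'"
proof -
  have "a * b' = b' * (b * a) * b'" using assms(3) by (simp add: mult.assoc[symmetric])
  also have "\<dots> = b' * (emb (q powi (- e)) * (a * b)) * b'"
    using qcommute_sym[OF assms(1)] by (simp add: qcommute_def)
  also have "\<dots> = emb (q powi (- e)) * (b' * a * (b * b'))"
    by (simp add: emb_left_commute mult.assoc)
  finally show ?thesis using assms(2) by (simp add: qcommute_def)
qed

lemma qcommute_prod_list: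
  "(\<And>z. z \<in> set zs \<Longrightarrow> qcommute (e z) a (f z)) \<Longrightarrow>
    qcommute (sum_list (map e zs)) a (prod_list (map f zs))"
  by (induction zs) (auto simp: qcommute_1_right qcommute_mult_right)

lemma qcommute_exchange:
  assumes az: "qcommute e a z" and bz: "qcommute f b z" and ab: "qcommute g a b"
  shows "a * (z * b) = emb (q powi (e + g - f)) * (b * (z * a))"
proof -
  have "a * (z * b) = emb (q powi (e + g)) * ((z * b) * a)"
    using qcommute_mult_right[OF az ab] unfolding qcommute_def .
  also have "(z * b) * a = emb (q powi (- f)) * (b * z) * a"
    using qcommute_sym[OF bz] by (simp add: qcommute_def)
  finally show ?thesis using emb_powi_add[of "e + g" "- f"] by (simp add: mult.assoc)
qed

lemma prod_list_exchange:
  assumes "s < t" "t < k" and eq: "\<And>u. u < k \<Longrightarrow> u \<noteq> s \<Longrightarrow> u \<noteq> t \<Longrightarrow> f u = g u"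
    and exchange: "f s * (prod_list (map f [Suc s..<t]) * f t) =
      emb a * (g s * (prod_list (map f [Suc s..<t]) * g t))"
  shows "prod_list (map f [0..<k]) = emb a * prod_list (map g [0..<k])"
proof -
  let ?before = "prod_list (map g [0..<s])" and ?between = "prod_list (map g [Suc s..<t])"
    and ?after = "prod_list (map g [Suc t..<k])"
  have same: "map f [0..<s] = map g [0..<s]" "map f [Suc s..<t] = map g [Suc s..<t]"
    "map f [Suc t..<k] = map g [Suc t..<k]"
    using assms(1,2) by (auto intro!: eq)
  have "prod_list (map f [0..<k]) = ?before * (f s * (?between * f t)) * ?after"
    unfolding upt_split_at_two[OF assms(1,2)] by (simp add: same mult.assoc)
  also have "f s * (?between * f t) = emb a * (g s * (?between * g t))"
    using exchange by (simp add: same)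
  also have "?before * (emb a * (g s * (?between * g t))) * ?after =
    emb a * prod_list (map g [0..<k])"
    unfolding upt_split_at_two[OF assms(1,2)] by (simp add: mult.assoc emb_left_commute)
  finally show ?thesis .
qed

end

section \<open>SE-graphs\<close>

locale se_digraph =
  fixes V :: "'v set" and E :: "('v \<times> 'v) set" and pos :: "'v \<Rightarrow> point"
    and m n :: nat and r c :: "nat \<Rightarrow> 'v"
  assumes se_graph: "se_graph V E pos m n r c"
begin

abbreviation "sources \<equiv> r ` {1..m}"
abbreviation "sinks \<equiv> c ` {1..n}"
abbreviation "W \<equiv> inner_vertices V m n r c"
abbreviation "walk \<equiv> successively (\<lambda>u v. (u, v) \<in> E)"
abbreviation "hsum \<equiv> step_sum (is_H pos)"

definition level :: "'v \<Rightarrow> real" where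
  "level u = fst (pos u) - snd (pos u)"

definition route :: "'v list \<Rightarrow> nat \<Rightarrow> nat \<Rightarrow> bool" where
  "route p i j \<longleftrightarrow> i \<in> {1..m} \<and> j \<in> {1..n} \<and> is_path E p (r i) (c j)"

lemma finite_V: "finite V" and edges_subset: "E \<subseteq> V \<times> V"
  and sources_subset: "sources \<subseteq> V"
  and inj_on_sources: "inj_on r {1..m}" and inj_on_sinks: "inj_on c {1..n}"
  and sources_sinks_disjoint: "sources \<inter> sinks = {}"
  and edges_H_or_V: "\<forall>(u, v)\<in>E. is_H pos u v \<or> is_V pos u v"
  and source_edges_H: "\<forall>(u, v)\<in>E. u \<in> sources \<or> v \<in> sources \<longrightarrow> is_H pos u v"
  and sink_edges_V: "\<forall>(u, v)\<in>E. u \<in> sinks \<or> v \<in> sinks \<longrightarrow> is_V pos u v"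
  and planar: "\<forall>e\<in>E. \<forall>e'\<in>E. e \<noteq> e' \<longrightarrow>
    edge_seg pos e \<inter> edge_seg pos e' \<subseteq> pos ` ({fst e, snd e} \<inter> {fst e', snd e'})"
  and vertex_on_edge: "\<forall>w\<in>V. \<forall>e\<in>E. pos w \<in> edge_seg pos e \<longrightarrow> w = fst e \<or> w = snd e"
  and sources_vertical: "\<forall>i\<in>{1..m}. \<forall>i'\<in>{1..m}. fst (pos (r i)) = fst (pos (r i'))"
  and sources_ascending: "\<forall>i\<in>{1..m}. \<forall>i'\<in>{1..m}. i < i' \<longrightarrow> snd (pos (r i)) < snd (pos (r i'))"
  and sinks_horizontal: "\<forall>j\<in>{1..n}. \<forall>j'\<in>{1..n}. snd (pos (c j)) = snd (pos (c j'))"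
  and sinks_rightward: "\<forall>j\<in>{1..n}. \<forall>j'\<in>{1..n}. j < j' \<longrightarrow> fst (pos (c j)) < fst (pos (c j'))"
  and vertices_on_paths:
    "\<forall>w\<in>V. \<exists>i\<in>{1..m}. \<exists>j\<in>{1..n}. \<exists>p. is_path E p (r i) (c j) \<and> w \<in> set p"
  using se_graph[unfolded se_graph_def] by - (elim conjE, assumption)+

lemma edge_in_V: "(u, v) \<in> E \<Longrightarrow> u \<in> V \<and> v \<in> V"
  and edge_H_or_V: "(u, v) \<in> E \<Longrightarrow> is_H pos u v \<or> is_V pos u v"
  and source_edge_H: "(u, v) \<in> E \<Longrightarrow> u \<in> sources \<or> v \<in> sources \<Longrightarrow> is_H pos u v"
  and sink_edge_V: "(u, v) \<in> E \<Longrightarrow> u \<in> sinks \<or> v \<in> sinks \<Longrightarrow> is_V pos u v"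
  using edges_subset edges_H_or_V source_edges_H sink_edges_V by blast+

lemma vertex_on_route: "w \<in> V \<Longrightarrow> \<exists>p i j. route p i j \<and> w \<in> set p"
  using vertices_on_paths unfolding route_def by blast

lemma H_not_V: "is_H pos u v \<Longrightarrow> \<not> is_V pos u v"
  by (auto simp: is_H_def is_V_def)

lemma edge_coords:
  assumes "(u, v) \<in> E"
  shows "fst (pos u) \<le> fst (pos v)" "snd (pos v) \<le> snd (pos u)" "level u < level v"
  using edge_H_or_V[OF assms] by (auto simp: level_def is_H_def is_V_def)

lemma walk_sorted_level: "walk p \<Longrightarrow> sorted_wrt (\<lambda>u v. level u < level v) p"
  by (subst successively_conv_sorted_wrt[symmetric])
    (auto simp: transp_def dest: edge_coords elim!: successively_mono)

lemma walk_sorted_coords: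
  "walk p \<Longrightarrow> sorted_wrt (\<lambda>u v. fst (pos u) \<le> fst (pos v) \<and> snd (pos v) \<le> snd (pos u)) p"
  by (subst successively_conv_sorted_wrt[symmetric])
    (auto simp: transp_def dest: edge_coords elim!: successively_mono)

lemma walk_distinct: "walk p \<Longrightarrow> distinct p"
  and walk_inj_on_level: "walk p \<Longrightarrow> inj_on level (set p)"
  using walk_sorted_level[of p] strict_sorted_iff[of "map level p"]
  by (auto simp: sorted_wrt_map distinct_map)

lemma path_subset_V:
  assumes "is_path E p u v" "u \<in> V"
  shows "set p \<subseteq> V"
  using assms
proof (induction p arbitrary: u rule: induct_list012)
  case (3 a b p)
  then show ?case using edge_in_V[of a b] by (auto simp: is_path_Cons_Cons_iff)
qed auto

lemma path_coords:
  assumes "is_path E p u v" "w \<in> set p"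
  shows "fst (pos u) \<le> fst (pos w)" "snd (pos w) \<le> snd (pos u)"
    and "fst (pos w) \<le> fst (pos v)" "snd (pos v) \<le> snd (pos w)"
proof -
  obtain xs ys where p: "p = xs @ w # ys" using assms(2) by (metis split_list)
  have walk: "walk p" and u: "u = hd (xs @ [w])" and v: "v = last (w # ys)"
    using assms(1) by (auto simp: is_path_iff_successively p hd_append)
  show "fst (pos u) \<le> fst (pos w)" "snd (pos w) \<le> snd (pos u)"
    using walk_sorted_coords[OF walk] by (cases xs; simp add: u p sorted_wrt_append)+
  show "fst (pos w) \<le> fst (pos v)" "snd (pos v) \<le> snd (pos w)"
    using walk_sorted_coords[OF walk] last_in_set[of ys]
    by (cases "ys = []"; simp add: v p sorted_wrt_append)+
qed

lemma path_levels:
  assumes "is_path E p u v" "w \<in> set p"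
  shows "level u \<le> level w" "level w \<le> level v"
  using path_coords[OF assms] by (auto simp: level_def)

lemma path_split_levels:
  assumes "is_path E (as @ v # bs) u w"
  shows "z \<in> set as \<Longrightarrow> level z < level v" "z \<in> set bs \<Longrightarrow> level v < level z"
  using assms walk_sorted_level[of "as @ v # bs"]
  by (auto simp: is_path_iff_successively sorted_wrt_append)

lemma edge_seg_iff:
  assumes "(u, v) \<in> E"
  shows "(a, b) \<in> edge_seg pos (u, v) \<longleftrightarrow>
    fst (pos u) \<le> a \<and> a \<le> fst (pos v) \<and> snd (pos v) \<le> b \<and> b \<le> snd (pos u)"
  using edge_H_or_V[OF assms]
proof
  assume "is_H pos u v"
  then show ?thesis
    by (auto simp: edge_seg_def is_H_def closed_segment_same_snd closed_segment_eq_real_ivl)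
next
  assume "is_V pos u v"
  then show ?thesis
    by (auto simp: edge_seg_def is_V_def closed_segment_same_fst closed_segment_eq_real_ivl)
qed

lemma vertex_in_edge_rectangle:
  assumes "w \<in> V" "(u, v) \<in> E"
    and "fst (pos u) \<le> fst (pos w)" "fst (pos w) \<le> fst (pos v)"
    and "snd (pos v) \<le> snd (pos w)" "snd (pos w) \<le> snd (pos u)"
  shows "w = u \<or> w = v"
proof -
  have "pos w \<in> edge_seg pos (u, v)"
    using edge_seg_iff[OF assms(2), of "fst (pos w)" "snd (pos w)"] assms(3-6) by simp
  then show ?thesis using vertex_on_edge assms(1,2) by fastforce
qed

lemma successor_unique:
  assumes "(u, v) \<in> E" "(u, v') \<in> E" "is_H pos u v = is_H pos u v'"
  shows "v = v'"
proof -
  have "v = v'"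
    if v: "(u, v) \<in> E" "(u, v') \<in> E" "is_H pos u v = is_H pos u v'" "level v \<le> level v'" for v v'
  proof -
    have "v = u \<or> v = v'"
      using v edge_H_or_V[OF v(1)] edge_H_or_V[OF v(2)] edge_in_V[OF v(1)]
      by (intro vertex_in_edge_rectangle) (auto simp: is_H_def is_V_def level_def)
    then show ?thesis using edge_coords(3)[OF v(1)] by auto
  qed
  then show ?thesis using assms by (metis linear)
qed

lemma predecessor_unique:
  assumes "(u, v) \<in> E" "(u', v) \<in> E" "is_H pos u v = is_H pos u' v"
  shows "u = u'"
proof -
  have "u = u'"
    if u: "(u, v) \<in> E" "(u', v) \<in> E" "is_H pos u v = is_H pos u' v" "level u' \<le> level u" for u u'
  proof -
    have "u = u' \<or> u = v"
      using u edge_H_or_V[OF u(1)] edge_H_or_V[OF u(2)] edge_in_V[OF u(1)]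
      by (intro vertex_in_edge_rectangle) (auto simp: is_H_def is_V_def level_def)
    then show ?thesis using edge_coords(3)[OF u(1)] by auto
  qed
  then show ?thesis using assms by (metis linear)
qed

lemma inj_on_edge_direction: "inj_on (is_H pos u) {v. (u, v) \<in> E}"
  using successor_unique by (auto simp: inj_on_def)

lemma no_edge_into_source:
  assumes "(u, v) \<in> E"
  shows "v \<notin> sources"
proof
  assume "v \<in> sources"
  then obtain i where i: "i \<in> {1..m}" "v = r i" by blast
  obtain p i' j where "route p i' j" "u \<in> set p" using vertex_on_route edge_in_V[OF assms] by blast
  then have "fst (pos (r i)) \<le> fst (pos u)"
    using path_coords(1) sources_vertical i(1) unfolding route_def by metis
  then show False using source_edge_H[OF assms] \<open>v \<in> sources\<close> i(2) by (auto simp: is_H_def)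
qed

lemma no_edge_from_sink:
  assumes "(u, v) \<in> E"
  shows "u \<notin> sinks"
proof
  assume "u \<in> sinks"
  then obtain j where j: "j \<in> {1..n}" "u = c j" by blast
  obtain p i j' where "route p i j'" "v \<in> set p" using vertex_on_route edge_in_V[OF assms] by blast
  then have "snd (pos (c j)) \<le> snd (pos v)"
    using path_coords(4) sinks_horizontal j(1) unfolding route_def by metis
  then show False using sink_edge_V[OF assms] \<open>u \<in> sinks\<close> j(2) by (auto simp: is_V_def)
qed

lemma path_source_eq_start:
  assumes "is_path E p u v" "w \<in> set p" "w \<in> sources"
  shows "w = u"
proof -
  obtain xs ys where "p = xs @ w # ys" using assms(2) by (metis split_list)
  then have "is_path E (xs @ [w]) u w" using assms(1) is_path_prefix by metis
  then show ?thesis using no_edge_into_source[of _ w] assms(3)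
    by (cases xs rule: rev_cases) (auto simp: is_path_iff_successively successively_append_iff)
qed

lemma path_sink_eq_end:
  assumes "is_path E p u v" "w \<in> set p" "w \<in> sinks"
  shows "w = v"
proof -
  obtain xs ys where "p = xs @ w # ys" using assms(2) by (metis split_list)
  then have "is_path E (w # ys) w v" using assms(1) is_path_suffix by metis
  then show ?thesis using no_edge_from_sink[of w] assms(3)
    by (cases ys) (auto simp: is_path_Cons_Cons_iff)
qed

lemma route_endpoints:
  assumes "route p i j"
  shows "is_path E p (r i) (c j)" "i \<in> {1..m}" "j \<in> {1..n}" "r i \<in> sources" "c j \<in> sinks"
    and "r i \<noteq> c j"
  using assms sources_sinks_disjoint unfolding route_def by blast+

lemma route_subset_V: "route p i j \<Longrightarrow> set p \<subseteq> V"
  using path_subset_V sources_subset by (meson route_endpoints(1,4) subsetD)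

lemma finite_routes: "finite {p. route p i j}"
proof (rule finite_subset[OF _ finite_subset_distinct[OF finite_V]])
  show "{p. route p i j} \<subseteq> {p. set p \<subseteq> V \<and> distinct p}"
    using route_subset_V walk_distinct by (auto simp: route_def is_path_iff_successively)
qed

lemma route_next_vertex:
  assumes "route p i j" "v \<in> set p" "v \<notin> sinks"
  obtains as a A where "p = as @ v # a # A" "(v, a) \<in> E"
proof -
  obtain as A where p: "p = as @ v # A" using assms(2) by (metis split_list)
  then have A: "is_path E (v # A) v (c j)"
    using route_endpoints(1)[OF assms(1)] is_path_suffix by metis
  with route_endpoints(5)[OF assms(1)] assms(3) obtain a A' where "A = a # A'"
    by (cases A) auto
  with p A that show thesis by (auto simp: is_path_Cons_Cons_iff)
qed

end

section \<open>The order of the sinks\<close>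

context se_digraph
begin

text \<open>
  Prolong a path by a horizontal ray to the left of its start and a vertical ray below its end.
  The prolonged path meets the line \<open>x - y = d\<close> in a single point, of abscissa \<open>abscissa p d\<close>.
\<close>

definition abscissa :: "'v list \<Rightarrow> real \<Rightarrow> real" where
  "abscissa p d = snd (pos (hd p)) + min d (level (hd p)) + hsum (\<lambda>w. min d (level w)) p"

lemma continuous_on_abscissa: "continuous_on X (abscissa p)"
  unfolding abscissa_def by (intro continuous_intros continuous_on_step_sum)

lemma hsum_level:
  "walk p \<Longrightarrow> p \<noteq> [] \<Longrightarrow> hsum level p = fst (pos (last p)) - fst (pos (hd p))"
proof (induction p rule: induct_list012)
  case (3 u v p)
  then show ?case using edge_H_or_V[of u v] H_not_V[of u v]
    by (auto simp: level_def is_H_def is_V_def)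
qed auto

lemma abscissa_before_start:
  assumes "is_path E p u v" "d \<le> level u"
  shows "abscissa p d = snd (pos u) + d"
proof -
  have "min d (level w) = d" if "w \<in> set p" for w
    using path_levels(1)[OF assms(1) that] assms(2) by simp
  then have "hsum (\<lambda>w. min d (level w)) p = 0" by (rule step_sum_const)
  then show ?thesis using assms by (simp add: abscissa_def is_path_def)
qed

lemma abscissa_after_end:
  assumes "is_path E p u v" "level v \<le> d"
  shows "abscissa p d = fst (pos v)"
proof -
  have p: "walk p" "p \<noteq> []" "hd p = u" "last p = v"
    using assms(1) by (auto simp: is_path_iff_successively)
  have below: "min d (level w) = level w" if "w \<in> set p" for w
    using path_levels(2)[OF assms(1) that] assms(2) by simp
  then have "hsum (\<lambda>w. min d (level w)) p = hsum level p" by (rule step_sum_cong)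
  then show ?thesis using p below[of u] is_path_endpoints(1)[OF assms(1)]
    by (simp add: abscissa_def hsum_level level_def)
qed

lemma abscissa_append:
  assumes "is_path E (as @ v # bs) u w" "level v \<le> d"
  shows "abscissa (as @ v # bs) d = abscissa (v # bs) d"
proof -
  have "abscissa (as @ [v]) d = fst (pos v)"
    using abscissa_after_end[OF is_path_prefix[OF assms(1)] assms(2)] .
  moreover have "hd (as @ v # bs) = hd (as @ [v])" by (simp add: hd_append)
  ultimately show ?thesis using assms(2)
    unfolding abscissa_def step_sum_append[of _ _ as v bs] by (auto simp: level_def)
qed

lemma abscissa_at_vertex:
  assumes "is_path E (as @ v # bs) u w"
  shows "abscissa (as @ v # bs) (level v) = fst (pos v)"
  using abscissa_append[OF assms] abscissa_before_start[OF is_path_suffix[OF assms]]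
  by (simp add: level_def)

lemma abscissa_first_step:
  assumes "is_path E (a # b # p) a v" "level a \<le> d" "d \<le> level b"
  shows "abscissa (a # b # p) d = fst (pos a) + (if is_H pos a b then d - level a else 0)"
proof -
  have p: "is_path E (b # p) b v" using assms(1) by (simp add: is_path_Cons_Cons_iff)
  have "min d (level w) = d" if "w \<in> set (b # p)" for w
    using path_levels(1)[OF p that] assms(3) by simp
  then have "hsum (\<lambda>w. min d (level w)) (b # p) = 0" by (rule step_sum_const)
  then show ?thesis using assms(2,3) by (auto simp: abscissa_def level_def)
qed

lemma abscissa_on_edge:
  assumes "is_path E p u v" "u \<noteq> v" "level u \<le> d" "d \<le> level v"
  shows "\<exists>a b. (a, b) \<in> E \<and> a \<in> set p \<and> b \<in> set p \<and>
    (abscissa p d, abscissa p d - d) \<in> edge_seg pos (a, b)"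
  using assms
proof (induction p arbitrary: u rule: induct_list012)
  case (3 a b p)
  have [simp]: "u = a" and ab: "(a, b) \<in> E" and p: "is_path E (b # p) b v"
    using "3.prems"(1) by (auto simp: is_path_Cons_Cons_iff)
  show ?case
  proof (cases "d \<le> level b")
    case True
    have "abscissa (a # b # p) d = fst (pos a) + (if is_H pos a b then d - level a else 0)"
      using abscissa_first_step[of a b p v d] "3.prems" True by simp
    then have "(abscissa (a # b # p) d, abscissa (a # b # p) d - d) \<in> edge_seg pos (a, b)"
      using edge_H_or_V[OF ab] H_not_V[of a b] "3.prems"(3) True unfolding edge_seg_iff[OF ab]
      by (auto simp: level_def is_H_def is_V_def)
    then show ?thesis using ab by (intro exI[of _ a] exI[of _ b]) simp
  next
    case False
    then have "b \<noteq> v" using "3.prems"(4) by auto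
    with "3.IH"(2)[OF p] False "3.prems"(4) obtain a' b' where
      "(a', b') \<in> E" "a' \<in> set (b # p)" "b' \<in> set (b # p)"
      "(abscissa (b # p) d, abscissa (b # p) d - d) \<in> edge_seg pos (a', b')" by fastforce
    moreover have "abscissa (a # b # p) d = abscissa (b # p) d"
      using abscissa_append[of "[a]" b p u v d] "3.prems"(1) False by simp
    ultimately show ?thesis by (intro exI[of _ a'] exI[of _ b']) simp
  qed
qed auto

lemma abscissa_less_start_iff:
  assumes path: "is_path E p u v" and "u \<noteq> v"
  shows "abscissa p d < fst (pos u) \<longleftrightarrow> d < level u"
proof (cases "d < level u")
  case True
  then show ?thesis using abscissa_before_start[OF path] by (simp add: level_def)
next
  case start: False
  have "fst (pos u) \<le> abscissa p d"
  proof (cases "d \<le> level v")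
    case True
    from abscissa_on_edge[OF assms leI[OF start] True] obtain a b where
      "(a, b) \<in> E" "a \<in> set p" "(abscissa p d, abscissa p d - d) \<in> edge_seg pos (a, b)" by blast
    then show ?thesis using path_coords(1)[OF path, of a] by (auto simp: edge_seg_iff)
  next
    case False
    then show ?thesis
      using abscissa_after_end[OF path] path_coords(1)[OF path is_path_endpoints(2)[OF path]]
      by simp
  qed
  with start show ?thesis by simp
qed

lemma abscissa_below_end_iff:
  assumes path: "is_path E p u v" and "u \<noteq> v"
  shows "abscissa p d - d < snd (pos v) \<longleftrightarrow> level v < d"
proof (cases "level v < d")
  case True
  then show ?thesis using abscissa_after_end[OF path] by (simp add: level_def)
next
  case "end": False
  have "snd (pos v) \<le> abscissa p d - d"
  proof (cases "level u \<le> d")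
    case True
    from abscissa_on_edge[OF assms True leI[OF "end"]] obtain a b where
      "(a, b) \<in> E" "b \<in> set p" "(abscissa p d, abscissa p d - d) \<in> edge_seg pos (a, b)" by blast
    then show ?thesis using path_coords(4)[OF path, of b] by (auto simp: edge_seg_iff)
  next
    case False
    then show ?thesis
      using abscissa_before_start[OF path] path_coords(4)[OF path is_path_endpoints(1)[OF path]]
      by simp
  qed
  with "end" show ?thesis by simp
qed

lemma edges_meet_at_vertex:
  assumes "(a, b) \<in> E" "(a', b') \<in> E"
    and z: "(x, y) \<in> edge_seg pos (a, b)" "(x, y) \<in> edge_seg pos (a', b')"
  shows "\<exists>w\<in>{a, b} \<inter> {a', b'}. x - y \<le> level w"
proof (cases "(a, b) = (a', b')")
  case True
  moreover have "x - y \<le> level b" using z(1) by (simp add: edge_seg_iff[OF assms(1)] level_def)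
  ultimately show ?thesis by blast
next
  case False
  then obtain w where "pos w = (x, y)" "w \<in> {a, b} \<inter> {a', b'}"
    using planar[rule_format, OF assms(1,2)] z by fastforce
  then show ?thesis by (intro bexI[of _ w]) (auto simp: level_def)
qed

lemma paths_meet_at_equal_abscissa:
  assumes path: "is_path E p u v" "u \<noteq> v" "level u \<le> d" "d \<le> level v"
    and path': "is_path E p' u' v'" "u' \<noteq> v'" "level u' \<le> d" "d \<le> level v'"
    and eq: "abscissa p d = abscissa p' d"
  shows "\<exists>w\<in>set p \<inter> set p'. d \<le> level w"
proof -
  obtain a b where ab: "(a, b) \<in> E" "a \<in> set p" "b \<in> set p"
    and on_ab: "(abscissa p d, abscissa p d - d) \<in> edge_seg pos (a, b)"
    using abscissa_on_edge[OF path] by blast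
  obtain a' b' where ab': "(a', b') \<in> E" "a' \<in> set p'" "b' \<in> set p'"
    and on_ab': "(abscissa p d, abscissa p d - d) \<in> edge_seg pos (a', b')"
    using abscissa_on_edge[OF path'] unfolding eq by blast
  obtain w where "w \<in> {a, b} \<inter> {a', b'}" "d \<le> level w"
    using edges_meet_at_vertex[OF ab(1) ab'(1) on_ab on_ab'] by auto
  then show ?thesis using ab(2,3) ab'(2,3) by blast
qed

lemma routes_meet_at_equal_abscissa:
  assumes route: "route p i j" and route': "route p' i' j'" and "j \<noteq> j'"
    and eq: "abscissa p d = abscissa p' d"
  shows "\<exists>w\<in>set p \<inter> set p'. d \<le> level w"
proof -
  note ends = route_endpoints[OF route] and ends' = route_endpoints[OF route']
  have same_x: "fst (pos (r i)) = fst (pos (r i'))" and same_y: "snd (pos (c j)) = snd (pos (c j'))"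
    using sources_vertical sinks_horizontal ends(2,3) ends'(2,3) by blast+
  have start: "d < level (r i) \<longleftrightarrow> d < level (r i')"
    using abscissa_less_start_iff[OF ends(1,6), of d] abscissa_less_start_iff[OF ends'(1,6), of d]
    by (simp add: eq same_x)
  have "end": "level (c j) < d \<longleftrightarrow> level (c j') < d"
    using abscissa_below_end_iff[OF ends(1,6), of d] abscissa_below_end_iff[OF ends'(1,6), of d]
    by (simp add: eq same_y)
  consider (before) "d < level (r i)" | (between) "level (r i) \<le> d" "d \<le> level (c j)"
    | (after) "level (c j) < d" by linarith
  then show ?thesis
  proof cases
    case before
    then have "snd (pos (r i)) = snd (pos (r i'))"
      using abscissa_before_start[OF ends(1), of d] abscissa_before_start[OF ends'(1), of d]
        eq start by simp
    then have "i = i'"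
      using sources_ascending ends(2) ends'(2) by (metis less_irrefl linorder_neqE_nat)
    then show ?thesis
      using is_path_endpoints(1)[OF ends(1)] is_path_endpoints(1)[OF ends'(1)] before by force
  next
    case between
    then show ?thesis
      using paths_meet_at_equal_abscissa[OF ends(1,6) _ _ ends'(1,6) _ _ eq] start "end" by simp
  next
    case after
    then have "fst (pos (c j)) = fst (pos (c j'))"
      using abscissa_after_end[OF ends(1), of d] abscissa_after_end[OF ends'(1), of d]
        eq "end" by simp
    then show ?thesis
      using sinks_rightward ends(3) ends'(3) \<open>j \<noteq> j'\<close> by (metis less_irrefl linorder_neqE_nat)
  qed
qed

text \<open>Routes arriving in the wrong order would meet by the intermediate value theorem.\<close>

lemma sinks_ordered_if_abscissa_less:
  assumes route: "route p i j" and route': "route p' i' j'" and "j \<noteq> j'"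
    and apart: "\<And>w. w \<in> set p \<Longrightarrow> w \<in> set p' \<Longrightarrow> level w < d"
    and less: "abscissa p d < abscissa p' d"
  shows "j < j'"
proof (rule ccontr)
  assume "\<not> j < j'"
  then have "fst (pos (c j')) < fst (pos (c j))"
    using \<open>j \<noteq> j'\<close> sinks_rightward route_endpoints(3)[OF route] route_endpoints(3)[OF route']
    by simp
  moreover define d' where "d' = Max {d, level (c j), level (c j')}"
  ultimately have "abscissa p' d' < abscissa p d'"
    using abscissa_after_end[OF route_endpoints(1)[OF route], of d']
      abscissa_after_end[OF route_endpoints(1)[OF route'], of d'] by simp
  then have "\<exists>e\<ge>d. e \<le> d' \<and> abscissa p e - abscissa p' e = 0"
    using less by (intro IVT') (auto simp: d'_def intro!: continuous_on_diff continuous_on_abscissa)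
  then obtain e where "d \<le> e" "abscissa p e = abscissa p' e" by auto
  with routes_meet_at_equal_abscissa[OF route route' \<open>j \<noteq> j'\<close>] apart show False by force
qed

lemma sinks_ordered_if_disjoint:
  assumes route: "route p i j" and route': "route p' i' j'" and "i < i'" and "set p \<inter> set p' = {}"
  shows "j < j'"
proof (rule sinks_ordered_if_abscissa_less[OF route route'])
  note ends = route_endpoints[OF route] and ends' = route_endpoints[OF route']
  show "j \<noteq> j'"
    using is_path_endpoints(2)[OF ends(1)] is_path_endpoints(2)[OF ends'(1)] assms(4) by auto
  have "snd (pos (r i)) < snd (pos (r i'))" "fst (pos (r i)) = fst (pos (r i'))"
    using sources_ascending sources_vertical ends(2) ends'(2) \<open>i < i'\<close> by blast+
  then show "abscissa p (level (r i')) < abscissa p' (level (r i'))"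
    using abscissa_before_start[OF ends(1), of "level (r i')"]
      abscissa_before_start[OF ends'(1), of "level (r i')"] by (simp add: level_def)
qed (use assms(4) in blast)

lemma sinks_ordered_if_branching:
  assumes route: "route (as @ v # a # A) i j" and route': "route (bs @ v # b # B) i' j'"
    and "j \<noteq> j'"
    and va_V: "is_V pos v a" and vb_H: "is_H pos v b"
    and last: "\<And>w. w \<in> set (as @ v # a # A) \<Longrightarrow> w \<in> set (bs @ v # b # B) \<Longrightarrow> level w \<le> level v"
  shows "j < j'"
proof -
  note ends = route_endpoints[OF route] and ends' = route_endpoints[OF route']
  have tail: "is_path E (v # a # A) v (c j)" and tail': "is_path E (v # b # B) v (c j')"
    using is_path_suffix[OF ends(1)] is_path_suffix[OF ends'(1)] .
  define d where "d = min (level a) (level b)"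
  have d: "level v < d" "d \<le> level a" "d \<le> level b"
    using tail tail' edge_coords(3)[of v a] edge_coords(3)[of v b]
    by (auto simp: d_def is_path_Cons_Cons_iff)
  have "abscissa (as @ v # a # A) d < abscissa (bs @ v # b # B) d"
    using abscissa_append[OF ends(1), of d] abscissa_append[OF ends'(1), of d]
      abscissa_first_step[OF tail, of d] abscissa_first_step[OF tail', of d]
      d va_V vb_H H_not_V[of v a] by auto
  moreover have "level w < d" if "w \<in> set (as @ v # a # A)" "w \<in> set (bs @ v # b # B)" for w
    using last[OF that] d(1) by simp
  ultimately show ?thesis using sinks_ordered_if_abscissa_less[OF route route' \<open>j \<noteq> j'\<close>] by blast
qed

lemma sink_not_between_tails:
  assumes route: "route (as @ v # A) i j" and route': "route (bs @ v # B) i' j'"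
    and route_R: "route R i'' j''"
    and "j'' \<noteq> j" "j'' \<noteq> j'"
    and apart: "\<And>w. w \<in> set (as @ v # A) \<Longrightarrow> w \<in> set R \<Longrightarrow> level w < level v"
      "\<And>w. w \<in> set (bs @ v # B) \<Longrightarrow> w \<in> set R \<Longrightarrow> level w < level v"
  shows "\<not> (j < j'' \<and> j'' < j')"
proof -
  note ends = route_endpoints[OF route] and ends' = route_endpoints[OF route']
  note at_v = abscissa_at_vertex[OF ends(1)] abscissa_at_vertex[OF ends'(1)]
  consider (left) "abscissa R (level v) < fst (pos v)"
    | (through) "abscissa R (level v) = fst (pos v)"
    | (right) "fst (pos v) < abscissa R (level v)" by linarith
  then show ?thesis
  proof cases
    case left
    then have "j'' < j"
      using at_v apart \<open>j'' \<noteq> j\<close>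
      by (intro sinks_ordered_if_abscissa_less[OF route_R route, of "level v"]) auto
    then show ?thesis by simp
  next
    case through
    with routes_meet_at_equal_abscissa[OF route_R route \<open>j'' \<noteq> j\<close>, of "level v"] at_v apart
      show ?thesis by force
  next
    case right
    then have "j' < j''"
      using at_v apart \<open>j'' \<noteq> j'\<close>
      by (intro sinks_ordered_if_abscissa_less[OF route' route_R, of "level v"]) auto
    then show ?thesis by simp
  qed
qed

end

section \<open>The skew form\<close>

context se_digraph
begin

definition hedges :: "('v \<times> 'v) set" where
  "hedges = {(u, v) \<in> E. is_H pos u v}"

definition vedges :: "('v \<times> 'v) set" where
  "vedges = {(u, v) \<in> E. is_V pos u v}"

lemma hpath_iff: "hpath E pos u v \<longleftrightarrow> (u, v) \<in> hedges\<^sup>+"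
  unfolding trancl_iff_is_path hpath_def by (auto simp: is_path_def hedges_def)

lemma vpath_iff: "vpath E pos u v \<longleftrightarrow> (u, v) \<in> vedges\<^sup>+"
  unfolding trancl_iff_is_path vpath_def by (auto simp: is_path_def vedges_def)

lemma is_H_if_hedges_trancl: "(u, v) \<in> hedges\<^sup>+ \<Longrightarrow> is_H pos u v"
  by (induction rule: trancl_induct) (auto simp: hedges_def is_H_def)

lemma is_V_if_vedges_trancl: "(u, v) \<in> vedges\<^sup>+ \<Longrightarrow> is_V pos u v"
  by (induction rule: trancl_induct) (auto simp: vedges_def is_V_def)

lemma acyclic_hedges: "acyclic hedges" and acyclic_vedges: "acyclic vedges"
  using is_H_if_hedges_trancl is_V_if_vedges_trancl
  by (fastforce simp: acyclic_def is_H_def is_V_def)+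

lemma single_valued_edges:
  "single_valued hedges" "single_valued (hedges\<inverse>)" "single_valued vedges" "single_valued (vedges\<inverse>)"
  using H_not_V
  by (auto intro!: single_valuedI intro: successor_unique predecessor_unique
      simp: hedges_def vedges_def)

text \<open>
  The generators satisfy \<open>x u * x w = q\<^sup>e * x w * x u\<close> with \<open>e = skew_form u w\<close>. Giving sources the
  value \<open>0\<close> amounts to replacing the generators they do not have by \<open>1\<close>.
\<close>

definition skew_form :: "'v \<Rightarrow> 'v \<Rightarrow> int" where
  "skew_form u w =
    (if u \<in> sources \<or> w \<in> sources then 0 else reach_sign hedges u w - reach_sign vedges u w)"

lemma skew_form_antisym: "skew_form u w = - skew_form w u"
  using reach_sign_antisym[of hedges u w] reach_sign_antisym[of vedges u w]
  by (simp add: skew_form_def)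

lemma skew_form_eq_1:
  assumes related: "(u, w) \<in> hedges\<^sup>+ \<or> (w, u) \<in> vedges\<^sup>+" and "u \<notin> sources" "w \<notin> sources"
  shows "skew_form u w = 1"
proof -
  note directions = is_H_if_hedges_trancl[of w u] is_H_if_hedges_trancl[of u w]
    is_V_if_vedges_trancl[of u w] is_V_if_vedges_trancl[of w u]
  from related have "reach_sign hedges u w - reach_sign vedges u w = 1"
  proof
    assume "(u, w) \<in> hedges\<^sup>+"
    with directions show ?thesis by (auto simp: reach_sign_def is_H_def is_V_def)
  next
    assume "(w, u) \<in> vedges\<^sup>+"
    with directions show ?thesis by (auto simp: reach_sign_def is_H_def is_V_def)
  qed
  then show ?thesis using assms(2,3) by (simp add: skew_form_def)
qed

lemma hsum_skew_form:
  assumes "is_path E p v s" "v \<notin> sources" "w \<notin> sources"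
  shows "hsum (\<lambda>u. skew_form u w) p = reach_sign vedges v w - reach_sign vedges s w
    - 2 * of_bool (w \<in> set p) + of_bool (w = v) + of_bool (w = s)"
  using assms
proof (induction p arbitrary: v rule: induct_list012)
  case (3 a b p)
  have [simp]: "v = a" and ab: "(a, b) \<in> E" and p: "is_path E (b # p) b s"
    using "3.prems"(1) by (auto simp: is_path_Cons_Cons_iff)
  have b: "b \<notin> sources" using no_edge_into_source[OF ab] .
  have "a \<notin> set (b # p)"
    using walk_distinct[of "a # b # p"] "3.prems"(1) by (auto simp: is_path_iff_successively)
  moreover have "(if is_H pos a b then skew_form b w - skew_form a w else 0) =
    reach_sign vedges a w - reach_sign vedges b w - of_bool (w = a) - of_bool (w = b)"
  proof (cases "is_H pos a b")
    case True
    then have "(a, b) \<in> hedges" using ab by (simp add: hedges_def)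
    from reach_sign_step[OF single_valued_edges(1,2) acyclic_hedges this, of w]
    show ?thesis using True "3.prems"(2,3) b by (simp add: skew_form_def)
  next
    case False
    then have "(a, b) \<in> vedges" using edge_H_or_V[OF ab] ab by (simp add: vedges_def)
    from reach_sign_step[OF single_valued_edges(3,4) acyclic_vedges this, of w]
    show ?thesis using False by simp
  qed
  ultimately show ?case using "3.IH"(2)[OF p b "3.prems"(3)] by simp
qed auto

definition lies_above :: "'v \<Rightarrow> 'v \<Rightarrow> int" where
  "lies_above s w = of_bool ((w, s) \<in> vedges\<^sup>*)"

lemma vedges_trancl_from_sink: "s \<in> sinks \<Longrightarrow> (s, w) \<notin> vedges\<^sup>+"
  using no_edge_from_sink[of s] by (auto dest!: tranclD simp: vedges_def)

lemma lies_above_source: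
  assumes "u \<in> sources" "s \<in> sinks"
  shows "lies_above s u = 0"
proof -
  have "(u, s) \<notin> vedges\<^sup>+"
    using source_edge_H[of u] H_not_V[of u] assms(1) by (auto dest!: tranclD simp: vedges_def)
  moreover have "u \<noteq> s" using assms sources_sinks_disjoint by blast
  ultimately show ?thesis by (simp add: lies_above_def rtrancl_eq_or_trancl)
qed

lemma lies_above_sink:
  assumes "s \<in> sinks" "t \<in> sinks"
  shows "lies_above s t = of_bool (t = s)"
  using vedges_trancl_from_sink[OF assms(2)] by (simp add: lies_above_def rtrancl_eq_or_trancl)

lemma hsum_lies_above:
  assumes path_R: "is_path E R u t" and "u \<in> sources" "t \<in> sinks" "s \<in> sinks"
  shows "hsum (lies_above s) R = of_bool (t = s)"
proof -
  have step: "is_H pos a b \<or> lies_above s a = lies_above s b" if "(a, b) \<in> E" for a b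
  proof -
    have "(a, s) \<in> vedges\<^sup>+ \<longleftrightarrow> (b, s) \<in> vedges\<^sup>*" if "(a, b) \<in> vedges"
      using trancl_iff_rtrancl_successor[OF single_valued_edges(3) that] .
    moreover have "a \<noteq> s" using no_edge_from_sink[OF that] \<open>s \<in> sinks\<close> by blast
    ultimately show ?thesis
      using edge_H_or_V[OF that] that by (auto simp: lies_above_def vedges_def rtrancl_eq_or_trancl)
  qed
  have "walk R" "R \<noteq> []" "hd R = u" "last R = t"
    using path_R by (auto simp: is_path_iff_successively)
  moreover have "successively (\<lambda>a b. is_H pos a b \<or> lies_above s a = lies_above s b) R"
    using \<open>walk R\<close> by (rule successively_mono) (rule step)
  ultimately have "hsum (lies_above s) R = lies_above s t - lies_above s u"
    using step_sum_telescope[of "is_H pos" "lies_above s" R] by simp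
  then show ?thesis using lies_above_source lies_above_sink assms by simp
qed

lemma hsum_skew_form_to_sink:
  assumes tail_A: "is_path E A v s" and "s \<in> sinks" "v \<notin> sources" "w \<notin> sources"
  shows "hsum (\<lambda>u. skew_form u w) A =
    lies_above s w - 2 * of_bool (w \<in> set A) + (reach_sign vedges v w + of_bool (w = v))"
  using hsum_skew_form[OF tail_A assms(3,4)] vedges_trancl_from_sink[OF assms(2)]
  by (auto simp: lies_above_def reach_sign_def rtrancl_eq_or_trancl)

definition path_skew_form :: "'v list \<Rightarrow> 'v list \<Rightarrow> int" where
  "path_skew_form p p' = hsum (\<lambda>w. hsum (\<lambda>u. skew_form u w) p) p'"

lemma path_skew_form_append:
  "path_skew_form p (as @ v # bs) = path_skew_form p (as @ [v]) + path_skew_form p (v # bs)"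
  unfolding path_skew_form_def by (rule step_sum_append)

lemma path_skew_form_self: "path_skew_form p p = 0"
  unfolding path_skew_form_def by (rule step_sum_antisym) (rule skew_form_antisym)

lemma path_skew_form_tails_diff:
  assumes tail_A: "is_path E A v s" "s \<in> sinks" and tail_B: "is_path E B v t" "t \<in> sinks"
    and v_not_source: "v \<notin> sources"
    and path_R: "is_path E R u t'" "u \<in> sources" "t' \<in> sinks"
  shows "path_skew_form A R - path_skew_form B R = of_bool (t' = s) - of_bool (t' = t) +
    2 * (hsum (\<lambda>w. of_bool (w \<in> set B)) R - hsum (\<lambda>w. of_bool (w \<in> set A)) R)"
proof -
  have pointwise: "hsum (\<lambda>u. skew_form u w) A - hsum (\<lambda>u. skew_form u w) B =
    (lies_above s w - lies_above t w) + 2 * (of_bool (w \<in> set B) - of_bool (w \<in> set A))" for w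
  proof (cases "w \<in> sources")
    case True
    then have "w \<notin> set A" "w \<notin> set B"
      using path_source_eq_start[OF tail_A(1)] path_source_eq_start[OF tail_B(1)] v_not_source
      by blast+
    then show ?thesis
      using True lies_above_source[OF True tail_A(2)] lies_above_source[OF True tail_B(2)]
      by (simp add: skew_form_def step_sum_const)
  next
    case False
    then show ?thesis
      using hsum_skew_form_to_sink[OF tail_A v_not_source]
        hsum_skew_form_to_sink[OF tail_B v_not_source] by simp
  qed
  have "path_skew_form A R - path_skew_form B R =
    hsum (\<lambda>w. hsum (\<lambda>u. skew_form u w) A - hsum (\<lambda>u. skew_form u w) B) R"
    by (simp add: path_skew_form_def step_sum_diff)
  also have "\<dots> = (hsum (lies_above s) R - hsum (lies_above t) R) +
    2 * (hsum (\<lambda>w. of_bool (w \<in> set B)) R - hsum (\<lambda>w. of_bool (w \<in> set A)) R)"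
    by (simp only: pointwise step_sum_add step_sum_mult step_sum_diff)
  finally show ?thesis
    using hsum_lies_above[OF path_R tail_A(2)] hsum_lies_above[OF path_R tail_B(2)] by simp
qed

lemma path_skew_form_tails_disjoint:
  assumes tail_A: "is_path E A v s" "s \<in> sinks" and tail_B: "is_path E B v t" "t \<in> sinks"
    and v_not_source: "v \<notin> sources"
    and path_R: "is_path E R u t'" "u \<in> sources" "t' \<in> sinks"
    and disjoint: "set R \<inter> (set A \<union> set B) = {}"
  shows "path_skew_form A R = path_skew_form B R"
proof -
  have "t' \<noteq> s" "t' \<noteq> t"
    using disjoint is_path_endpoints(2)[OF tail_A(1)] is_path_endpoints(2)[OF tail_B(1)]
      is_path_endpoints(2)[OF path_R(1)] by blast+
  moreover have "hsum (\<lambda>w. of_bool (w \<in> set B) :: int) R = 0"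
    "hsum (\<lambda>w. of_bool (w \<in> set A) :: int) R = 0"
    using disjoint by (auto intro!: step_sum_const[where a = 0])
  ultimately show ?thesis
    using path_skew_form_tails_diff[OF tail_A tail_B v_not_source path_R] by simp
qed

lemma hsum_tails_branching:
  assumes tail_A: "is_path E (v # A) v s" and path_Q: "is_path E (bs @ v # b # B) u t"
    and vb_H: "is_H pos v b" and meet: "set (v # A) \<inter> set (v # b # B) = {v}"
  shows "hsum (\<lambda>w. of_bool (w \<in> set (v # b # B))) (bs @ v # b # B)
    - hsum (\<lambda>w. of_bool (w \<in> set (v # A))) (bs @ v # b # B) = (1 :: int)"
proof -
  have tail_B: "is_path E (v # b # B) v t" using is_path_suffix[OF path_Q] .
  have "w \<notin> set (v # A)" "w \<notin> set (v # b # B)" if "w \<in> set bs" for w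
    using path_split_levels(1)[OF path_Q that] path_levels(1)[OF tail_A, of w]
      path_levels(1)[OF tail_B, of w] by auto
  then have before: "hsum (\<lambda>w. of_bool (w \<in> set (v # b # B)) :: int) (bs @ [v]) =
    hsum (\<lambda>w. of_bool (w \<in> set (v # A))) (bs @ [v])"
    by (intro step_sum_cong) auto
  have on_B: "hsum (\<lambda>w. of_bool (w \<in> set (v # b # B)) :: int) (v # b # B) = 0"
    by (rule step_sum_const[where a = 1]) simp
  have "v \<notin> set (b # B)"
    using walk_distinct[of "v # b # B"] tail_B by (auto simp: is_path_iff_successively)
  then have not_A: "w \<notin> set (v # A)" if "w \<in> set (b # B)" for w
    using that meet by (metis IntI list.set_intros(2) singletonD)
  then have "hsum (\<lambda>w. of_bool (w \<in> set (v # A)) :: int) (b # B) = 0"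
    by (intro step_sum_const[where a = 0]) simp
  then have on_A: "hsum (\<lambda>w. of_bool (w \<in> set (v # A)) :: int) (v # b # B) = - 1"
    using vb_H not_A[of b] by simp
  show ?thesis unfolding step_sum_append[of _ _ bs v "b # B"] before on_A on_B by simp
qed

lemma path_skew_form_tails_branching:
  assumes tail_A: "is_path E (v # A) v s" "s \<in> sinks"
    and tail_B: "is_path E (v # b # B) v t" "t \<in> sinks"
    and v_not_source: "v \<notin> sources" and vb_H: "is_H pos v b"
    and path_R: "is_path E (bs @ [v]) u v" "u \<in> sources"
    and meet: "set (v # A) \<inter> set (v # b # B) = {v}"
  shows "path_skew_form (v # A) (bs @ [v]) + path_skew_form (v # A) (v # b # B)
    - path_skew_form (v # b # B) (bs @ [v]) = 1"
proof -
  have path_Q: "is_path E (bs @ v # b # B) u t" using is_path_append[OF path_R(1) tail_B(1)] .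
  have "v \<notin> sinks" using no_edge_from_sink[of v b] tail_B(1) by (simp add: is_path_Cons_Cons_iff)
  then have "t \<noteq> s"
    using is_path_endpoints(2)[OF tail_A(1)] is_path_endpoints(2)[OF tail_B(1)] meet tail_A(2)
    by (metis IntI singletonD)
  then have "path_skew_form (v # A) (bs @ v # b # B)
    - path_skew_form (v # b # B) (bs @ v # b # B) = 1"
    using path_skew_form_tails_diff[OF tail_A tail_B v_not_source path_Q path_R(2) tail_B(2)]
      hsum_tails_branching[OF tail_A(1) path_Q vb_H meet] by simp
  then show ?thesis unfolding path_skew_form_append[of _ bs v "b # B"] path_skew_form_self by simp
qed

end

section \<open>Commutation of path weights\<close>

lemma path_weight_Nil [simp]: "path_weight pos m r x xinv [] = 1"
  and path_weight_singleton [simp]: "path_weight pos m r x xinv [u] = 1"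
  by (simp_all add: path_weight_def)

lemma path_weight_Cons_Cons:
  "path_weight pos m r x xinv (u # v # p) =
    edge_weight pos m r x xinv u v * path_weight pos m r x xinv (v # p)"
proof -
  have "[0..<Suc (length p)] = 0 # map Suc [0..<length p]"
    by (simp add: upt_conv_Cons map_Suc_upt del: upt_Suc)
  then show ?thesis unfolding path_weight_def by (simp add: o_def del: upt_Suc)
qed

lemma path_weight_append:
  "path_weight pos m r x xinv (as @ v # bs) =
    path_weight pos m r x xinv (as @ [v]) * path_weight pos m r x xinv (v # bs)"
proof (induction as)
  case (Cons a as)
  then show ?case by (cases as) (simp_all add: path_weight_Cons_Cons mult.assoc)
qed simp

locale se_algebra = se_digraph V E pos m n r c + q_algebra q emb
  for V :: "'v set" and E :: "('v \<times> 'v) set" and pos :: "'v \<Rightarrow> point"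
    and m n :: nat and r c :: "nat \<Rightarrow> 'v"
    and q :: "'k::field" and emb :: "'k \<Rightarrow> 'a::ring_1" +
  fixes x xinv :: "'v \<Rightarrow> 'a"
  assumes inv: "w \<in> W \<Longrightarrow> x w * xinv w = 1 \<and> xinv w * x w = 1"
    and relH: "u \<in> W \<Longrightarrow> v \<in> W \<Longrightarrow> u \<noteq> v \<Longrightarrow> hpath E pos u v \<Longrightarrow>
      x u * x v = emb q * x v * x u"
    and relV: "u \<in> W \<Longrightarrow> v \<in> W \<Longrightarrow> u \<noteq> v \<Longrightarrow> vpath E pos u v \<Longrightarrow>
      x v * x u = emb q * x u * x v"
    and relC: "u \<in> W \<Longrightarrow> v \<in> W \<Longrightarrow> u \<noteq> v \<Longrightarrow>
      \<not> hpath E pos u v \<Longrightarrow> \<not> hpath E pos v u \<Longrightarrow>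
      \<not> vpath E pos u v \<Longrightarrow> \<not> vpath E pos v u \<Longrightarrow> x u * x v = x v * x u"
begin

abbreviation "weight \<equiv> path_weight pos m r x xinv"

text \<open>Reading sources as \<open>1\<close> makes \<open>gen_inv u * gen v\<close> the weight of every H-edge \<open>(u, v)\<close>.\<close>

definition gen :: "'v \<Rightarrow> 'a" where
  "gen u = (if u \<in> sources then 1 else x u)"

definition gen_inv :: "'v \<Rightarrow> 'a" where
  "gen_inv u = (if u \<in> sources then 1 else xinv u)"

lemma W_iff: "w \<in> W \<longleftrightarrow> w \<in> V \<and> w \<notin> sources \<and> w \<notin> sinks"
  by (auto simp: inner_vertices_def)

lemma gen_inverse:
  assumes "u \<in> V - sinks"
  shows "gen u * gen_inv u = 1" "gen_inv u * gen u = 1"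
  using inv[of u] assms by (auto simp: gen_def gen_inv_def W_iff)

lemma edge_weight_eq:
  assumes "(u, v) \<in> E"
  shows "edge_weight pos m r x xinv u v = (if is_H pos u v then gen_inv u * gen v else 1)"
  using source_edge_H[OF assms] no_edge_into_source[OF assms]
  by (auto simp: edge_weight_def gen_def gen_inv_def)

lemma x_qcommute:
  assumes "u \<in> W" "w \<in> W" "u \<noteq> w"
  shows "qcommute (skew_form u w) (x u) (x w)"
proof -
  have related: "qcommute (skew_form u w) (x u) (x w)"
    if "hpath E pos u w \<or> vpath E pos w u" "u \<in> W" "w \<in> W" "u \<noteq> w" for u w
  proof -
    have "skew_form u w = 1"
      using that skew_form_eq_1[of u w] by (simp add: hpath_iff vpath_iff W_iff)
    then show ?thesis using that relH[of u w] relV[of w u] by (auto simp: qcommute_def mult.assoc)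
  qed
  consider (forward) "hpath E pos u w \<or> vpath E pos w u"
    | (backward) "hpath E pos w u \<or> vpath E pos u w"
    | (unrelated) "\<not> hpath E pos u w" "\<not> hpath E pos w u" "\<not> vpath E pos u w" "\<not> vpath E pos w u"
    by blast
  then show ?thesis
  proof cases
    case forward
    then show ?thesis using related assms by blast
  next
    case backward
    then have "qcommute (- skew_form w u) (x u) (x w)"
      using related assms by (blast intro: qcommute_sym)
    then show ?thesis using skew_form_antisym[of u w] by simp
  next
    case unrelated
    then have "skew_form u w = 0"
      by (simp add: skew_form_def reach_sign_def hpath_iff vpath_iff)
    then show ?thesis using relC[OF assms unrelated] by (simp add: qcommute_def emb_1)
  qed
qed

lemma gen_qcommute:
  assumes "u \<in> V - sinks" "w \<in> V - sinks"
  shows "qcommute (skew_form u w) (gen u) (gen w)"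
proof (cases "u \<in> sources \<or> w \<in> sources \<or> u = w")
  case True
  then show ?thesis
    by (auto simp: skew_form_def gen_def reach_sign_def
        qcommute_1_left qcommute_1_right qcommute_refl)
next
  case False
  then show ?thesis using x_qcommute[of u w] assms by (simp add: gen_def W_iff)
qed

lemma qcommute_edge_weight:
  assumes edge: "(u, v) \<in> E" and gen: "\<And>w. w \<in> V - sinks \<Longrightarrow> qcommute (e w) a (gen w)"
  shows "qcommute (if is_H pos u v then e v - e u else 0) a (edge_weight pos m r x xinv u v)"
proof (cases "is_H pos u v")
  case True
  then have inner: "u \<in> V - sinks" "v \<in> V - sinks"
    using edge_in_V[OF edge] sink_edge_V[OF edge] H_not_V by blast+
  have "qcommute (- e u) a (gen_inv u)"
    using qcommute_inverse_right[OF gen[OF inner(1)] gen_inverse[OF inner(1)]] .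
  from qcommute_mult_right[OF this gen[OF inner(2)]] show ?thesis
    using True by (simp add: edge_weight_eq[OF edge])
next
  case False
  then show ?thesis by (simp add: edge_weight_eq[OF edge] qcommute_1_right)
qed

lemma qcommute_weight:
  assumes "walk p" and gen: "\<And>w. w \<in> V - sinks \<Longrightarrow> qcommute (e w) a (gen w)"
  shows "qcommute (hsum e p) a (weight p)"
  using assms(1)
proof (induction p rule: induct_list012)
  case (3 u v p)
  then show ?case
    using qcommute_mult_right[OF qcommute_edge_weight[OF _ gen, of u v]]
    by (simp add: path_weight_Cons_Cons)
qed (simp_all add: qcommute_1_right)

lemma qcommute_weights:
  assumes "walk p" "walk p'"
  shows "qcommute (path_skew_form p p') (weight p) (weight p')"
  unfolding path_skew_form_def
proof (rule qcommute_weight[OF assms(2)])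
  fix w assume w: "w \<in> V - sinks"
  have "qcommute (- skew_form u w) (gen w) (gen u)" if "u \<in> V - sinks" for u
    using gen_qcommute[OF that w] by (rule qcommute_sym)
  from qcommute_sym[OF qcommute_weight[OF assms(1) this]]
  show "qcommute (hsum (\<lambda>u. skew_form u w) p) (weight p) (gen w)" by (simp add: step_sum_uminus)
qed

lemma qcommute_weight_prod:
  assumes "walk p" "walk p'" "\<And>R. R \<in> set Rs \<Longrightarrow> walk R"
  shows "qcommute (sum_list (map (path_skew_form p) Rs) + path_skew_form p p')
    (weight p) (prod_list (map weight Rs) * weight p')"
  using assms by (intro qcommute_mult_right qcommute_prod_list qcommute_weights)

lemma weight_exchange_tails:
  assumes tail_A: "is_path E (v # A) v s" "s \<in> sinks"
    and tail_B: "is_path E (v # b # B) v t" "t \<in> sinks"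
    and v_not_source: "v \<notin> sources" and vb_H: "is_H pos v b"
    and path_R: "is_path E (bs @ [v]) u v" "u \<in> sources"
    and meet: "set (v # A) \<inter> set (v # b # B) = {v}"
    and routes: "\<And>R. R \<in> set Rs \<Longrightarrow> \<exists>i j. route R i j"
    and avoid: "\<And>R. R \<in> set Rs \<Longrightarrow> set R \<inter> (set (v # A) \<union> set (v # b # B)) = {}"
  shows "weight (as @ v # A) * (prod_list (map weight Rs) * weight (bs @ v # b # B)) =
    emb q * (weight (as @ v # b # B) * (prod_list (map weight Rs) * weight (bs @ v # A)))"
proof -
  let ?A = "v # A" and ?B = "v # b # B" and ?b = "bs @ [v]" and ?M = "prod_list (map weight Rs)"
  let ?e = "\<lambda>p. sum_list (map (path_skew_form p) Rs) + path_skew_form p ?b"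
  have walks: "walk ?A" "walk ?B" "walk ?b" "\<And>R. R \<in> set Rs \<Longrightarrow> walk R"
    using tail_A(1) tail_B(1) path_R(1) routes by (auto simp: is_path_iff_successively route_def)
  have "path_skew_form ?A R = path_skew_form ?B R" if "R \<in> set Rs" for R
    using path_skew_form_tails_disjoint[OF tail_A tail_B v_not_source] avoid[OF that]
      routes[OF that] route_endpoints by metis
  then have same: "map (path_skew_form ?A) Rs = map (path_skew_form ?B) Rs" by simp
  have exponent: "?e ?A + path_skew_form ?A ?B - ?e ?B = 1"
    unfolding same
    using path_skew_form_tails_branching[OF tail_A tail_B v_not_source vb_H path_R meet] by linarith
  have "qcommute (?e ?A) (weight ?A) (?M * weight ?b)"
    "qcommute (?e ?B) (weight ?B) (?M * weight ?b)"
    using walks by (blast intro: qcommute_weight_prod)+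
  from qcommute_exchange[OF this qcommute_weights[OF walks(1,2)]] exponent
  have "weight ?A * (?M * weight ?b * weight ?B) =
    emb q * (weight ?B * (?M * weight ?b * weight ?A))"
    by simp
  then have "weight (as @ [v]) * (weight ?A * (?M * weight ?b * weight ?B)) =
    emb q * (weight (as @ [v]) * (weight ?B * (?M * weight ?b * weight ?A)))"
    by (simp add: emb_left_commute)
  moreover note split = path_weight_append[of pos m r x xinv]
  note split[of as v A] split[of bs v A] split[of as v "b # B"] split[of bs v "b # B"]
  ultimately show ?thesis by (simp only: mult.assoc)
qed

end

section \<open>Lists and inversions\<close>

lemma listset_Cons_conv_image: "listset (A # As) = (\<lambda>(a, as). a # as) ` (A \<times> listset As)"
  by (auto simp: set_Cons_def)

lemma finite_listset: "(\<And>A. A \<in> set As \<Longrightarrow> finite A) \<Longrightarrow> finite (listset As)"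
  by (induction As) (simp_all add: listset_Cons_conv_image del: listset.simps(2))

lemma listset_map_upt: "listset (map S [0..<k]) = {xs. length xs = k \<and> (\<forall>t<k. xs ! t \<in> S t)}"
proof -
  have "xs \<in> listset As \<longleftrightarrow> list_all2 (\<in>) xs As" for xs :: "'a list" and As
    by (induction As arbitrary: xs) (auto simp: set_Cons_def list_all2_Cons2)
  then show ?thesis by (auto simp: list_all2_conv_all_nth)
qed

lemma prod_list_sum:
  fixes f :: "'b \<Rightarrow> 'a::semiring_1"
  shows "prod_list (map (sum f) As) = (\<Sum>as\<in>listset As. prod_list (map f as))"
proof (induction As)
  case (Cons A As)
  have "prod_list (map (sum f) (A # As)) = (\<Sum>(a, as)\<in>A \<times> listset As. prod_list (map f (a # as)))"
    by (simp add: Cons.IH sum_product sum.cartesian_product)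
  also have "\<dots> = (\<Sum>as\<in>listset (A # As). prod_list (map f as))"
    unfolding listset_Cons_conv_image
    by (subst sum.reindex) (auto simp: inj_on_def case_prod_unfold)
  finally show ?case .
qed simp

lemma map_upt_eq_sorted_list_of_set:
  assumes "finite J" "strict_mono_on {..<card J} j" "j ` {..<card J} \<subseteq> J"
  shows "map j [0..<card J] = sorted_list_of_set J"
proof -
  have "card (j ` {..<card J}) = card J"
    using strict_mono_on_imp_inj_on[OF assms(2)] by (simp add: card_image)
  then have "set (map j [0..<card J]) = J"
    using card_subset_eq[OF assms(1,3)] by (simp add: atLeast0LessThan)
  moreover have "sorted_wrt (<) (map j [0..<card J])"
    using assms(2) by (auto simp: sorted_wrt_iff_nth_less strict_mono_on_def)
  ultimately show ?thesis
    using assms(1) by (intro strict_sorted_equal) simp_all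
qed

lemma inversions_id: "inversions id k = 0"
proof -
  have "{(a, b). a < b \<and> b < k \<and> id b < (id a :: nat)} = {}" by auto
  then show ?thesis by (simp only: inversions_def card.empty)
qed

lemma inversions_transpose:
  assumes inj: "inj_on \<sigma> {..<k}" and "s < t" "t < k" and adjacent: "\<sigma> t = Suc (\<sigma> s)"
  shows "inversions (\<sigma> \<circ> Transposition.transpose s t) k = Suc (inversions \<sigma> k)"
proof -
  let ?inv = "\<lambda>\<sigma>. {(a, b). a < b \<and> b < k \<and> \<sigma> b < (\<sigma> a :: nat)}"
  have other: "\<sigma> u \<noteq> \<sigma> s \<and> \<sigma> u \<noteq> Suc (\<sigma> s)" if "u < k" "u \<noteq> s" "u \<noteq> t" for u
    using inj_onD[OF inj, of u s] inj_onD[OF inj, of u t] that assms(2,3) adjacent by auto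
  have "(a, b) \<in> ?inv (\<sigma> \<circ> Transposition.transpose s t) \<longleftrightarrow> (a, b) \<in> insert (s, t) (?inv \<sigma>)" for a b
    using other[of a] other[of b] adjacent assms(2,3)
    by (auto simp: Transposition.transpose_def not_less_eq less_Suc_eq)
  then have "?inv (\<sigma> \<circ> Transposition.transpose s t) = insert (s, t) (?inv \<sigma>)" by auto
  moreover have "finite (?inv \<sigma>)"
    by (rule finite_subset[of _ "{..<k} \<times> {..<k}"]) auto
  moreover have "(s, t) \<notin> ?inv \<sigma>" using adjacent by auto
  ultimately show ?thesis unfolding inversions_def by simp
qed

lemma sorted_wrt_filter_append:
  fixes f :: "'a \<Rightarrow> 'b::linorder"
  assumes "sorted_wrt (\<lambda>u v. f u < f v) xs"
  shows "filter (\<lambda>w. f w \<le> d) xs @ filter (\<lambda>w. d < f w) xs = xs"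
  using assms
proof (induction xs)
  case (Cons u xs)
  then show ?case
  proof (cases "f u \<le> d")
    case False
    with Cons.prems have "\<forall>w\<in>set xs. d < f w" by auto
    then have "filter (\<lambda>w. f w \<le> d) xs = []" "filter (\<lambda>w. d < f w) xs = xs"
      by (auto simp: filter_empty_conv)
    then show ?thesis using False by simp
  qed simp
qed simp

section \<open>Exchanging tails\<close>

context se_digraph
begin

definition crossover :: "real \<Rightarrow> 'v list \<Rightarrow> 'v list \<Rightarrow> 'v list" where
  "crossover d p p' = filter (\<lambda>w. level w \<le> d) p @ filter (\<lambda>w. d < level w) p'"

lemma in_set_crossover_iff:
  "w \<in> set (crossover d p p') \<longleftrightarrow> (if level w \<le> d then w \<in> set p else w \<in> set p')"
  by (auto simp: crossover_def)

lemma crossover_self: "walk p \<Longrightarrow> crossover d p p = p"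
  unfolding crossover_def by (rule sorted_wrt_filter_append) (rule walk_sorted_level)

lemma crossover_crossover:
  "crossover d (crossover d p\<^sub>1 p\<^sub>2) (crossover d p\<^sub>3 p\<^sub>4) = crossover d p\<^sub>1 p\<^sub>4"
  by (auto simp: crossover_def filter_empty_conv)

lemma crossover_append:
  assumes "is_path E (as @ v # A) u w" "is_path E (bs @ v # B) u' w'"
  shows "crossover (level v) (as @ v # A) (bs @ v # B) = as @ v # B"
proof -
  have "filter (\<lambda>z. level z \<le> level v) as = as" "filter (\<lambda>z. level z \<le> level v) A = []"
    using path_split_levels[OF assms(1)]
    by (auto simp: filter_id_conv filter_empty_conv less_imp_le not_le)
  moreover have "filter (\<lambda>z. level v < level z) bs = []" "filter (\<lambda>z. level v < level z) B = B"
    using path_split_levels[OF assms(2)]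
    by (auto simp: filter_id_conv filter_empty_conv less_imp_le not_less)
  ultimately show ?thesis by (simp add: crossover_def)
qed

lemma is_path_crossover:
  assumes p: "is_path E p u w" and p': "is_path E p' u' w'" and "v \<in> set p" "v \<in> set p'"
  shows "is_path E (crossover (level v) p p') u w'"
proof -
  obtain as A bs B where split: "p = as @ v # A" "p' = bs @ v # B"
    using assms(3,4) by (metis split_list)
  have "is_path E (as @ v # B) u w'"
    using is_path_append[OF is_path_prefix is_path_suffix] p p' unfolding split .
  then show ?thesis using crossover_append p p' unfolding split by simp
qed

end

section \<open>The minor as a sum over systems of paths\<close>

locale se_minor = se_algebra V E pos m n r c q emb x xinv
  for V :: "'v set" and E :: "('v \<times> 'v) set" and pos :: "'v \<Rightarrow> point"
    and m n :: nat and r c :: "nat \<Rightarrow> 'v"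
    and q :: "'k::field" and emb :: "'k \<Rightarrow> 'a::ring_1" and x xinv :: "'v \<Rightarrow> 'a" +
  fixes I J :: "nat set"
  assumes I_subset: "I \<subseteq> {1..m}" and J_subset: "J \<subseteq> {1..n}" and card_I_eq_J: "card I = card J"
begin

abbreviation "k \<equiv> card I"
abbreviation "src t \<equiv> sorted_list_of_set I ! t"
abbreviation "snk t \<equiv> sorted_list_of_set J ! t"

lemma finite_I: "finite I" and finite_J: "finite J"
  using I_subset J_subset finite_subset by blast+

lemma src_in: "t < k \<Longrightarrow> src t \<in> {1..m}" and snk_in: "t < k \<Longrightarrow> snk t \<in> J"
  using I_subset card_I_eq_J
    nth_mem[of t "sorted_list_of_set I"] nth_mem[of t "sorted_list_of_set J"]
  by (auto simp: finite_I finite_J)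

lemma strict_mono_on_src: "strict_mono_on {..<k} ((!) (sorted_list_of_set I))"
  and strict_mono_on_snk: "strict_mono_on {..<k} ((!) (sorted_list_of_set J))"
  using card_I_eq_J sorted_wrt_nth_less[of "(<)" "sorted_list_of_set I"]
    sorted_wrt_nth_less[of "(<)" "sorted_list_of_set J"]
  by (auto simp: strict_mono_on_def)

lemma src_eq_iff: "s < k \<Longrightarrow> t < k \<Longrightarrow> src s = src t \<longleftrightarrow> s = t"
  and snk_less_iff: "s < k \<Longrightarrow> t < k \<Longrightarrow> snk s < snk t \<longleftrightarrow> s < t"
  and snk_eq_iff: "s < k \<Longrightarrow> t < k \<Longrightarrow> snk s = snk t \<longleftrightarrow> s = t"
  using strict_mono_on_eq[OF strict_mono_on_src] strict_mono_on_less[OF strict_mono_on_snk]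
    strict_mono_on_eq[OF strict_mono_on_snk] by auto

definition systems :: "(nat \<Rightarrow> nat) \<Rightarrow> 'v list list set" where
  "systems \<sigma> = listset (map (\<lambda>t. {p. route p (src t) (snk (\<sigma> t))}) [0..<k])"

definition all_systems :: "((nat \<Rightarrow> nat) \<times> 'v list list) set" where
  "all_systems = (SIGMA \<sigma>:{\<sigma>. \<sigma> permutes {..<k}}. systems \<sigma>)"

definition signed_weight :: "(nat \<Rightarrow> nat) \<times> 'v list list \<Rightarrow> 'a" where
  "signed_weight = (\<lambda>(\<sigma>, P). emb ((- q) ^ inversions \<sigma> k) * prod_list (map weight P))"

lemma systems_iff: "P \<in> systems \<sigma> \<longleftrightarrow> length P = k \<and> (\<forall>t<k. route (P ! t) (src t) (snk (\<sigma> t)))"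
  by (simp add: systems_def listset_map_upt)

lemma
  assumes system: "(\<sigma>, P) \<in> all_systems"
  shows system_length: "length P = k" and system_permutes: "\<sigma> permutes {..<k}"
    and system_perm_less: "t < k \<Longrightarrow> \<sigma> t < k"
    and system_route: "t < k \<Longrightarrow> route (P ! t) (src t) (snk (\<sigma> t))"
    and system_walk: "t < k \<Longrightarrow> walk (P ! t)"
  using system permutes_in_image[of \<sigma> "{..<k}" t]
  by (auto simp: all_systems_def systems_iff route_def is_path_iff_successively)

lemma finite_systems: "finite (systems \<sigma>)"
  unfolding systems_def by (rule finite_listset) (auto simp: finite_routes)

lemma finite_all_systems: "finite all_systems"
  unfolding all_systems_def by (intro finite_SigmaI finite_systems finite_permutations) simp

lemma prod_path_matrix:
  assumes "\<sigma> permutes {..<k}"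
  shows "prod_list (map (\<lambda>t. path_matrix E pos m r c x xinv (src t) (snk (\<sigma> t))) [0..<k]) =
    (\<Sum>P\<in>systems \<sigma>. prod_list (map weight P))"
proof -
  have "path_matrix E pos m r c x xinv (src t) (snk (\<sigma> t)) =
    sum weight {p. route p (src t) (snk (\<sigma> t))}"
    if "t < k" for t
  proof -
    have "\<sigma> t < k" using permutes_in_image[OF assms, of t] that by simp
    then have "snk (\<sigma> t) \<in> {1..n}" using snk_in J_subset by blast
    then show ?thesis using src_in[OF that] by (simp add: path_matrix_def route_def)
  qed
  then have "map (\<lambda>t. path_matrix E pos m r c x xinv (src t) (snk (\<sigma> t))) [0..<k] =
    map (sum weight) (map (\<lambda>t. {p. route p (src t) (snk (\<sigma> t))}) [0..<k])" by simp
  then show ?thesis by (simp only: systems_def prod_list_sum)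
qed

lemma qminor_eq_sum_all_systems:
  "qminor emb q (path_matrix E pos m r c x xinv) I J = sum signed_weight all_systems"
  by (simp add: qminor_def all_systems_def signed_weight_def Let_def prod_path_matrix
      sum_distrib_left sum.Sigma[symmetric] finite_systems finite_permutations)

section \<open>The last shared vertex\<close>

definition shared :: "'v list list \<Rightarrow> 'v set" where
  "shared P = {w. \<exists>s\<in>{..<k}. \<exists>t\<in>{..<k}. s \<noteq> t \<and> w \<in> set (P ! s) \<and> w \<in> set (P ! t)}"

definition intersecting :: "((nat \<Rightarrow> nat) \<times> 'v list list) set" where
  "intersecting = {(\<sigma>, P) \<in> all_systems. shared P \<noteq> {}}"

text \<open>
  The pivot depends on \<open>P\<close> only through \<open>shared P\<close>, which exchanging tails does not change;
  this makes the exchange an involution.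
\<close>

definition pivot :: "'v list list \<Rightarrow> 'v" where
  "pivot P = arg_min_on (\<lambda>w. - level w) (shared P)"

definition crossing :: "'v list list \<Rightarrow> nat set" where
  "crossing P = {u. u < k \<and> pivot P \<in> set (P ! u)}"

lemma system_if_intersecting: "(\<sigma>, P) \<in> intersecting \<Longrightarrow> (\<sigma>, P) \<in> all_systems"
  by (simp add: intersecting_def)

lemma sharedI: "s < k \<Longrightarrow> t < k \<Longrightarrow> s \<noteq> t \<Longrightarrow> w \<in> set (P ! s) \<Longrightarrow> w \<in> set (P ! t) \<Longrightarrow> w \<in> shared P"
  by (auto simp: shared_def)

lemma shared_not_sink:
  assumes "(\<sigma>, P) \<in> all_systems" "w \<in> shared P"
  shows "w \<notin> sinks"
proof
  assume "w \<in> sinks"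
  obtain s t where st: "s < k" "t < k" "s \<noteq> t" "w \<in> set (P ! s)" "w \<in> set (P ! t)"
    using assms(2) by (auto simp: shared_def)
  note s = route_endpoints[OF system_route[OF assms(1) st(1)]]
    and t = route_endpoints[OF system_route[OF assms(1) st(2)]]
  have "c (snk (\<sigma> s)) = c (snk (\<sigma> t))"
    using path_sink_eq_end[OF s(1)] path_sink_eq_end[OF t(1)] st(4,5) \<open>w \<in> sinks\<close> by metis
  then have "\<sigma> s = \<sigma> t"
    using inj_onD[OF inj_on_sinks] s(3) t(3) snk_eq_iff system_perm_less[OF assms(1)] st(1,2)
    by metis
  then show False using permutes_inj[OF system_permutes[OF assms(1)]] st(3) by (auto simp: inj_def)
qed

lemma shared_not_source:
  assumes "(\<sigma>, P) \<in> all_systems" "w \<in> shared P"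
  shows "w \<notin> sources"
proof
  assume "w \<in> sources"
  obtain s t where st: "s < k" "t < k" "s \<noteq> t" "w \<in> set (P ! s)" "w \<in> set (P ! t)"
    using assms(2) by (auto simp: shared_def)
  note s = route_endpoints[OF system_route[OF assms(1) st(1)]]
    and t = route_endpoints[OF system_route[OF assms(1) st(2)]]
  have "r (src s) = r (src t)"
    using path_source_eq_start[OF s(1)] path_source_eq_start[OF t(1)] st(4,5) \<open>w \<in> sources\<close> by metis
  then show False using inj_onD[OF inj_on_sources] s(2) t(2) src_eq_iff st(1-3) by metis
qed

lemma finite_shared:
  assumes "(\<sigma>, P) \<in> all_systems"
  shows "finite (shared P)"
proof (rule finite_subset[OF _ finite_V])
  show "shared P \<subseteq> V"
    using route_subset_V system_route[OF assms] by (fastforce simp: shared_def)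
qed

lemma pivot_in_shared: "(\<sigma>, P) \<in> intersecting \<Longrightarrow> pivot P \<in> shared P"
  unfolding pivot_def intersecting_def using finite_shared by (auto intro!: arg_min_if_finite)

lemma level_le_pivot:
  assumes "(\<sigma>, P) \<in> intersecting" "w \<in> shared P"
  shows "level w \<le> level (pivot P)"
  using arg_min_least[OF finite_shared _ assms(2), of \<sigma> "\<lambda>w. - level w"] assms
  by (auto simp: pivot_def intersecting_def)

lemma level_less_pivot_off_crossing:
  assumes meeting: "(\<sigma>, P) \<in> intersecting" and "u < k" "u \<notin> crossing P" "s \<in> crossing P"
    and w: "w \<in> set (P ! s)" "w \<in> set (P ! u)"
  shows "level w < level (pivot P)"
proof -
  have s: "s < k" "pivot P \<in> set (P ! s)" and "pivot P \<notin> set (P ! u)"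
    using assms(2-4) by (auto simp: crossing_def)
  with w(2) have "w \<noteq> pivot P" by blast
  moreover have "inj_on level (set (P ! s))"
    using walk_inj_on_level[OF system_walk[OF system_if_intersecting[OF meeting] s(1)]] .
  ultimately have "level w \<noteq> level (pivot P)" using inj_onD w(1) s(2) by metis
  moreover have "level w \<le> level (pivot P)"
    using level_le_pivot[OF meeting sharedI[of s u w P]] s(1) assms(2-4) w by blast
  ultimately show ?thesis by simp
qed

lemma crossing_directions_inj:
  assumes meeting: "(\<sigma>, P) \<in> intersecting"
  obtains f where "\<And>u. u \<in> crossing P \<Longrightarrow> \<exists>as A. P ! u = as @ pivot P # f u # A"
    and "\<And>u. u \<in> crossing P \<Longrightarrow> (pivot P, f u) \<in> E"
    and "inj_on (\<lambda>u. is_H pos (pivot P) (f u)) (crossing P)"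
proof -
  let ?v = "pivot P"
  have "?v \<notin> sinks"
    using shared_not_sink[OF system_if_intersecting[OF meeting] pivot_in_shared[OF meeting]] .
  then have "\<exists>a as A. P ! u = as @ ?v # a # A \<and> (?v, a) \<in> E" if "u \<in> crossing P" for u
    using route_next_vertex[OF system_route[OF system_if_intersecting[OF meeting], of u]] that
    unfolding crossing_def by blast
  then obtain f where f: "\<And>u. u \<in> crossing P \<Longrightarrow> \<exists>as A. P ! u = as @ ?v # f u # A \<and> (?v, f u) \<in> E"
    by metis
  have "u = u'" if u: "u \<in> crossing P" "u' \<in> crossing P" "f u = f u'" for u u'
  proof (rule ccontr)
    assume "u \<noteq> u'"
    moreover have "f u \<in> set (P ! u)" using f[OF u(1)] by auto
    moreover have "f u \<in> set (P ! u')" using f[OF u(2)] u(3) by auto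
    ultimately have "f u \<in> shared P"
      using u(1,2) by (intro sharedI[of u u']) (auto simp: crossing_def)
    then show False
      using level_le_pivot[OF meeting] edge_coords(3)[of ?v "f u"] f[OF u(1)] by fastforce
  qed
  then have "inj_on f (crossing P)" by (auto simp: inj_on_def)
  moreover have "f ` crossing P \<subseteq> {a. (?v, a) \<in> E}" using f by blast
  ultimately have "inj_on (is_H pos ?v \<circ> f) (crossing P)"
    by (intro comp_inj_on) (auto intro: inj_on_subset[OF inj_on_edge_direction])
  with f that show thesis unfolding comp_def by blast
qed

lemma crossing_pair:
  assumes meeting: "(\<sigma>, P) \<in> intersecting"
  obtains s t as a A bs b B where "s < t" "t < k" "crossing P = {s, t}"
    and "P ! s = as @ pivot P # a # A" "P ! t = bs @ pivot P # b # B"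
    and "is_V pos (pivot P) a \<and> is_H pos (pivot P) b \<or> is_H pos (pivot P) a \<and> is_V pos (pivot P) b"
proof -
  obtain s t where st: "s < t" "t < k" "{s, t} \<subseteq> crossing P"
    using pivot_in_shared[OF meeting] unfolding shared_def crossing_def
    by (force elim: linorder_neqE_nat)
  obtain f where f: "\<And>u. u \<in> crossing P \<Longrightarrow> \<exists>as A. P ! u = as @ pivot P # f u # A"
    and edge: "\<And>u. u \<in> crossing P \<Longrightarrow> (pivot P, f u) \<in> E"
    and inj: "inj_on (\<lambda>u. is_H pos (pivot P) (f u)) (crossing P)"
    using crossing_directions_inj[OF meeting] by blast
  have "card (crossing P) \<le> card (UNIV :: bool set)"
    by (rule card_inj_on_le[OF inj]) auto
  then have "crossing P = {s, t}"
    using st by (intro card_seteq[symmetric]) (auto simp: crossing_def)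
  moreover have "is_V pos (pivot P) (f s) \<and> is_H pos (pivot P) (f t) \<or>
      is_H pos (pivot P) (f s) \<and> is_V pos (pivot P) (f t)"
    using inj_onD[OF inj, of s t] st edge_H_or_V[OF edge] by auto
  moreover obtain as A bs B where "P ! s = as @ pivot P # f s # A" "P ! t = bs @ pivot P # f t # B"
    using f[of s] f[of t] st(3) by blast
  ultimately show thesis using that st(1,2) by blast
qed

section \<open>The sign-reversing involution\<close>

definition crossing_swap :: "'v list list \<Rightarrow> nat \<Rightarrow> nat" where
  "crossing_swap P = Transposition.transpose (Min (crossing P)) (Max (crossing P))"

definition exchange :: "(nat \<Rightarrow> nat) \<Rightarrow> real \<Rightarrow> 'v list list \<Rightarrow> 'v list list" where
  "exchange \<tau> d P = map (\<lambda>u. crossover d (P ! u) (P ! \<tau> u)) [0..<k]"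

lemma nth_exchange: "u < k \<Longrightarrow> exchange \<tau> d P ! u = crossover d (P ! u) (P ! \<tau> u)"
  by (simp add: exchange_def)

lemma exchange_in_systems:
  assumes system: "(\<sigma>, P) \<in> all_systems" and \<tau>: "\<tau> permutes {..<k}"
    and through: "\<And>u. u < k \<Longrightarrow> \<tau> u \<noteq> u \<Longrightarrow> v \<in> set (P ! u) \<and> v \<in> set (P ! \<tau> u)"
  shows "(\<sigma> \<circ> \<tau>, exchange \<tau> (level v) P) \<in> all_systems"
proof -
  have "route (exchange \<tau> (level v) P ! u) (src u) (snk ((\<sigma> \<circ> \<tau>) u))" if u: "u < k" for u
  proof (cases "\<tau> u = u")
    case True
    then show ?thesis
      using system_route[OF system u] system_walk[OF system u] u
      by (simp add: nth_exchange crossover_self)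
  next
    case False
    have "\<tau> u < k" using permutes_in_image[OF \<tau>, of u] u by simp
    then show ?thesis
      using system_route[OF system u] system_route[OF system, of "\<tau> u"] through[OF u False] u
      by (auto simp: nth_exchange route_def intro: is_path_crossover)
  qed
  then show ?thesis
    using permutes_compose[OF \<tau> system_permutes[OF system]]
    by (simp add: all_systems_def systems_iff exchange_def)
qed

lemma shared_exchange:
  assumes \<tau>: "\<tau> permutes {..<k}"
  shows "shared (exchange \<tau> d P) = shared P"
proof (rule set_eqI)
  fix w
  define \<rho> where "\<rho> = (if level w \<le> d then id else \<tau>)"
  have \<rho>: "\<rho> ` {..<k} = {..<k}" "inj \<rho>"
    using permutes_image[OF \<tau>] permutes_inj[OF \<tau>] by (auto simp: \<rho>_def)
  have "w \<in> shared (exchange \<tau> d P) \<longleftrightarrow>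
    (\<exists>s\<in>{..<k}. \<exists>t\<in>{..<k}. \<rho> s \<noteq> \<rho> t \<and> w \<in> set (P ! \<rho> s) \<and> w \<in> set (P ! \<rho> t))"
    using \<rho>(2) by (auto simp: shared_def nth_exchange in_set_crossover_iff \<rho>_def inj_eq)
  also have "\<dots> \<longleftrightarrow> (\<exists>s\<in>\<rho> ` {..<k}. \<exists>t\<in>\<rho> ` {..<k}. s \<noteq> t \<and> w \<in> set (P ! s) \<and> w \<in> set (P ! t))"
    by blast
  also have "\<dots> \<longleftrightarrow> w \<in> shared P" unfolding \<rho>(1) shared_def by simp
  finally show "w \<in> shared (exchange \<tau> d P) \<longleftrightarrow> w \<in> shared P" .
qed

lemma exchange_exchange:
  assumes system: "(\<sigma>, P) \<in> all_systems" and \<tau>: "\<tau> permutes {..<k}" "\<And>u. \<tau> (\<tau> u) = u"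
  shows "exchange \<tau> d (exchange \<tau> d P) = P"
proof (rule nth_equalityI)
  fix u assume "u < length (exchange \<tau> d (exchange \<tau> d P))"
  then have u: "u < k" "\<tau> u < k"
    using permutes_in_image[OF \<tau>(1), of u] by (simp_all add: exchange_def)
  then show "exchange \<tau> d (exchange \<tau> d P) ! u = P ! u"
    by (simp add: nth_exchange crossover_crossover \<tau>(2) crossover_self system_walk[OF system])
qed (simp add: exchange_def system_length[OF system])

lemma crossing_swap_eq:
  "crossing P = {s, t} \<Longrightarrow> s < t \<Longrightarrow> crossing_swap P = Transposition.transpose s t"
  by (simp add: crossing_swap_def)

lemma crossing_swap_involution: "crossing_swap P (crossing_swap P u) = u"
  by (simp add: crossing_swap_def)

lemma crossing_swap_permutes:
  assumes "(\<sigma>, P) \<in> intersecting"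
  shows "crossing_swap P permutes {..<k}"
proof -
  obtain s t where "s < t" "t < k" "crossing P = {s, t}" using crossing_pair[OF assms] by metis
  then show ?thesis by (auto simp: crossing_swap_eq intro: permutes_swap_id)
qed

definition exchange_tails :: "'v list list \<Rightarrow> 'v list list" where
  "exchange_tails P = exchange (crossing_swap P) (level (pivot P)) P"

lemma
  assumes "(\<sigma>, P) \<in> intersecting"
  shows shared_exchange_tails: "shared (exchange_tails P) = shared P"
    and pivot_exchange_tails: "pivot (exchange_tails P) = pivot P"
    and crossing_exchange_tails: "crossing (exchange_tails P) = crossing P"
proof -
  show shared: "shared (exchange_tails P) = shared P"
    using shared_exchange[OF crossing_swap_permutes[OF assms]] by (simp add: exchange_tails_def)
  then show pivot: "pivot (exchange_tails P) = pivot P" by (simp add: pivot_def)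
  show "crossing (exchange_tails P) = crossing P"
    unfolding crossing_def pivot
    by (auto simp: exchange_tails_def nth_exchange in_set_crossover_iff)
qed

lemma exchange_tails_in_systems:
  assumes meeting: "(\<sigma>, P) \<in> intersecting"
  shows "(\<sigma> \<circ> crossing_swap P, exchange_tails P) \<in> all_systems"
  unfolding exchange_tails_def
proof (rule exchange_in_systems[OF system_if_intersecting crossing_swap_permutes])
  fix u assume "crossing_swap P u \<noteq> u"
  moreover obtain s t where "s < t" "crossing P = {s, t}" using crossing_pair[OF meeting] by metis
  ultimately have "{u, crossing_swap P u} \<subseteq> crossing P"
    by (auto simp: crossing_swap_eq Transposition.transpose_def split: if_splits)
  then show "pivot P \<in> set (P ! u) \<and> pivot P \<in> set (P ! crossing_swap P u)"
    by (auto simp: crossing_def)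
qed (fact meeting)+

definition swap_tails :: "(nat \<Rightarrow> nat) \<times> 'v list list \<Rightarrow> (nat \<Rightarrow> nat) \<times> 'v list list" where
  "swap_tails = (\<lambda>(\<sigma>, P). (\<sigma> \<circ> crossing_swap P, exchange_tails P))"

lemma swap_tails_in_intersecting:
  assumes "z \<in> intersecting"
  shows "swap_tails z \<in> intersecting"
proof (cases z)
  case (Pair \<sigma> P)
  then have meeting: "(\<sigma>, P) \<in> intersecting" using assms by simp
  then show ?thesis
    using exchange_tails_in_systems[OF meeting] shared_exchange_tails[OF meeting]
    by (simp add: Pair swap_tails_def intersecting_def)
qed

lemma swap_tails_involution:
  assumes "z \<in> intersecting"
  shows "swap_tails (swap_tails z) = z"
proof (cases z)
  case (Pair \<sigma> P)
  then have meeting: "(\<sigma>, P) \<in> intersecting" using assms by simp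
  have swap: "crossing_swap (exchange_tails P) = crossing_swap P"
    by (simp add: crossing_swap_def crossing_exchange_tails[OF meeting])
  have "exchange_tails (exchange_tails P) =
    exchange (crossing_swap P) (level (pivot P)) (exchange_tails P)"
    using swap pivot_exchange_tails[OF meeting]
    by (simp add: exchange_tails_def[of "exchange_tails P"])
  also have "\<dots> = P"
    unfolding exchange_tails_def
    using system_if_intersecting[OF meeting] crossing_swap_permutes[OF meeting]
      crossing_swap_involution by (rule exchange_exchange)
  finally show ?thesis
    using swap by (simp add: Pair swap_tails_def comp_def crossing_swap_involution)
qed

lemma swap_tails_neq:
  assumes "z \<in> intersecting"
  shows "swap_tails z \<noteq> z"
proof (cases z)
  case (Pair \<sigma> P)
  then have meeting: "(\<sigma>, P) \<in> intersecting" using assms by simp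
  obtain s t where st: "s < t" "crossing P = {s, t}" using crossing_pair[OF meeting] by metis
  then have "(\<sigma> \<circ> crossing_swap P) s \<noteq> \<sigma> s"
    using permutes_inj[OF system_permutes[OF system_if_intersecting[OF meeting]]]
    by (auto simp: crossing_swap_eq inj_def)
  then have "\<sigma> \<circ> crossing_swap P \<noteq> \<sigma>" by metis
  then show ?thesis by (simp add: Pair swap_tails_def)
qed

context
  fixes \<sigma> P s t as a A bs b B
  assumes meeting: "(\<sigma>, P) \<in> intersecting" and crossing_eq: "crossing P = {s, t}" and "s < t"
    and P_s: "P ! s = as @ pivot P # a # A" and P_t: "P ! t = bs @ pivot P # b # B"
begin

lemma crossing_less: "s < k" "t < k"
  using crossing_eq by (auto simp: crossing_def)

lemma crossing_routes:
  "route (as @ pivot P # a # A) (src s) (snk (\<sigma> s))"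
  "route (bs @ pivot P # b # B) (src t) (snk (\<sigma> t))"
  using system_route[OF system_if_intersecting[OF meeting]] crossing_less P_s P_t by metis+

lemma nth_exchange_crossing:
  "exchange_tails P ! s = as @ pivot P # b # B"
  "exchange_tails P ! t = bs @ pivot P # a # A"
  using crossing_less \<open>s < t\<close> route_endpoints(1)[OF crossing_routes(1)]
    route_endpoints(1)[OF crossing_routes(2)]
  by (simp_all add: exchange_tails_def nth_exchange crossing_swap_eq[OF crossing_eq] P_s P_t
      crossover_append)

lemma nth_exchange_off_crossing:
  assumes "u < k" "u \<noteq> s" "u \<noteq> t"
  shows "exchange_tails P ! u = P ! u"
  using assms \<open>s < t\<close> system_walk[OF system_if_intersecting[OF meeting]]
  by (simp add: exchange_tails_def nth_exchange crossing_swap_eq[OF crossing_eq] crossover_self)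

lemma level_le_pivot_if_crossing:
  assumes "w \<in> set (as @ pivot P # a # A)" "w \<in> set (bs @ pivot P # b # B)"
  shows "level w \<le> level (pivot P)"
  using level_le_pivot[OF meeting sharedI[of s t]] assms P_s P_t crossing_less \<open>s < t\<close> by simp

lemma crossing_tails_meet: "set (pivot P # a # A) \<inter> set (pivot P # b # B) = {pivot P}"
proof -
  have "w = pivot P" if "w \<in> set (pivot P # a # A)" "w \<in> set (pivot P # b # B)" for w
    using level_le_pivot_if_crossing[of w] that
      path_split_levels(2)[OF route_endpoints(1)[OF crossing_routes(1)], of w] by fastforce
  then show ?thesis by auto
qed

lemma level_less_pivot_if_off_crossing:
  assumes "u < k" "u \<noteq> s" "u \<noteq> t" "w \<in> set (P ! u)"
    and "w \<in> set (as @ pivot P # a # A) \<or> w \<in> set (bs @ pivot P # b # B)"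
  shows "level w < level (pivot P)"
  using level_less_pivot_off_crossing[OF meeting assms(1)] assms(2-5) crossing_eq P_s P_t
  by (metis insert_iff singletonD)

lemma off_crossing_avoids_tails:
  assumes "u < k" "u \<noteq> s" "u \<noteq> t"
  shows "set (P ! u) \<inter> (set (pivot P # a # A) \<union> set (pivot P # b # B)) = {}"
proof -
  have "level (pivot P) \<le> level w" if "w \<in> set (pivot P # a # A) \<union> set (pivot P # b # B)" for w
    using that path_split_levels(2)[OF route_endpoints(1)[OF crossing_routes(1)], of w]
      path_split_levels(2)[OF route_endpoints(1)[OF crossing_routes(2)], of w] by fastforce
  moreover have "level w < level (pivot P)"
    if "w \<in> set (P ! u)" "w \<in> set (pivot P # a # A) \<union> set (pivot P # b # B)" for w
    using level_less_pivot_if_off_crossing[OF assms that(1)] that(2) by auto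
  ultimately show ?thesis by (meson disjoint_iff not_less)
qed

context
  assumes a_V: "is_V pos (pivot P) a" and b_H: "is_H pos (pivot P) b"
begin

lemma crossing_sinks_adjacent: "\<sigma> t = Suc (\<sigma> s)"
proof -
  note P_system = system_if_intersecting[OF meeting]
  note \<sigma> = system_permutes[OF P_system] system_perm_less[OF P_system]
  note snk_iffs = snk_eq_iff[OF \<sigma>(2) \<sigma>(2)] snk_less_iff[OF \<sigma>(2) \<sigma>(2)]
  have "\<sigma> s \<noteq> \<sigma> t" using permutes_inj[OF \<sigma>(1)] \<open>s < t\<close> by (auto simp: inj_def)
  then have "snk (\<sigma> s) \<noteq> snk (\<sigma> t)" using snk_iffs crossing_less by blast
  then have "snk (\<sigma> s) < snk (\<sigma> t)"
    using sinks_ordered_if_branching[OF crossing_routes] a_V b_H level_le_pivot_if_crossing by blast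
  then have "\<sigma> s < \<sigma> t" using snk_iffs crossing_less by blast
  moreover have "\<not> Suc (\<sigma> s) < \<sigma> t"
  proof
    assume gap: "Suc (\<sigma> s) < \<sigma> t"
    then have "Suc (\<sigma> s) < k" using \<sigma>(2)[OF crossing_less(2)] by simp
    then obtain u where u: "u < k" "\<sigma> u = Suc (\<sigma> s)"
      using permutes_image[OF \<sigma>(1)] by (metis imageE lessThan_iff)
    have between: "\<sigma> s < \<sigma> u" "\<sigma> u < \<sigma> t" using u(2) gap by simp_all
    then have "u \<noteq> s" "u \<noteq> t" by auto
    note below = level_less_pivot_if_off_crossing[OF u(1) this]
    have "snk (\<sigma> u) \<noteq> snk (\<sigma> s)" "snk (\<sigma> u) \<noteq> snk (\<sigma> t)"
      using snk_iffs crossing_less u(1) between by simp_all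
    then have "\<not> (snk (\<sigma> s) < snk (\<sigma> u) \<and> snk (\<sigma> u) < snk (\<sigma> t))"
      using sink_not_between_tails[OF crossing_routes system_route[OF P_system u(1)]] below by blast
    then show False using snk_iffs crossing_less u(1) between by simp
  qed
  ultimately show ?thesis by simp
qed

lemma prod_weight_exchange:
  "prod_list (map weight P) = emb q * prod_list (map weight (exchange_tails P))"
proof -
  let ?M = "prod_list (map weight (map ((!) P) [Suc s..<t]))"
  note P_system = system_if_intersecting[OF meeting]
  note ends = route_endpoints[OF crossing_routes(1)]
    and ends' = route_endpoints[OF crossing_routes(2)]
  have "weight (P ! s) * (?M * weight (P ! t)) =
    emb q * (weight (exchange_tails P ! s) * (?M * weight (exchange_tails P ! t)))"
    unfolding nth_exchange_crossing P_s P_t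
  proof (rule weight_exchange_tails)
    show "is_path E (pivot P # a # A) (pivot P) (c (snk (\<sigma> s)))"
      "is_path E (pivot P # b # B) (pivot P) (c (snk (\<sigma> t)))"
      "is_path E (bs @ [pivot P]) (r (src t)) (pivot P)"
      using is_path_suffix[OF ends(1)] is_path_suffix[OF ends'(1)] is_path_prefix[OF ends'(1)] .
    show "pivot P \<notin> sources" using shared_not_source[OF P_system pivot_in_shared[OF meeting]] .
    fix R assume "R \<in> set (map ((!) P) [Suc s..<t])"
    then obtain u where u: "R = P ! u" "u < k" "u \<noteq> s" "u \<noteq> t" using crossing_less(2) by auto
    then show "\<exists>i j. route R i j" using system_route[OF P_system] by blast
    show "set R \<inter> (set (pivot P # a # A) \<union> set (pivot P # b # B)) = {}"
      using off_crossing_avoids_tails u by blast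
  qed (fact ends(5) ends'(4,5) b_H crossing_tails_meet)+
  then have "prod_list (map (\<lambda>u. weight (P ! u)) [0..<k]) =
    emb q * prod_list (map (\<lambda>u. weight (exchange_tails P ! u)) [0..<k])"
    using nth_exchange_off_crossing
    by (intro prod_list_exchange[OF \<open>s < t\<close> crossing_less(2)]) (simp_all add: comp_def)
  moreover have "map weight Q = map (\<lambda>u. weight (Q ! u)) [0..<k]" if "length Q = k" for Q
    using that by (intro nth_equalityI) simp_all
  ultimately show ?thesis
    using system_length[OF P_system] by (simp add: exchange_tails_def exchange_def del: map_map)
qed

lemma signed_weight_swap_tails_vertical_first:
  "signed_weight (swap_tails (\<sigma>, P)) = - signed_weight (\<sigma>, P)"
proof -
  have "inj_on \<sigma> {..<k}"
    using permutes_inj_on[OF system_permutes[OF system_if_intersecting[OF meeting]]] .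
  then have "inversions (\<sigma> \<circ> crossing_swap P) k = Suc (inversions \<sigma> k)"
    unfolding crossing_swap_eq[OF crossing_eq \<open>s < t\<close>]
    using \<open>s < t\<close> crossing_less(2) crossing_sinks_adjacent by (rule inversions_transpose)
  then show ?thesis
    by (simp add: swap_tails_def signed_weight_def prod_weight_exchange power_Suc2
        emb_mult emb_uminus mult.assoc del: power_Suc)
qed

end

end

lemma signed_weight_swap_tails:
  assumes "z \<in> intersecting"
  shows "signed_weight (swap_tails z) + signed_weight z = 0"
proof (cases z)
  case (Pair \<sigma> P)
  then have meeting: "(\<sigma>, P) \<in> intersecting" using assms by simp
  obtain s t as a A bs b B where st: "s < t" "t < k" "crossing P = {s, t}"
    and split: "P ! s = as @ pivot P # a # A" "P ! t = bs @ pivot P # b # B"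
    and directions: "is_V pos (pivot P) a \<and> is_H pos (pivot P) b \<or>
      is_H pos (pivot P) a \<and> is_V pos (pivot P) b"
    using crossing_pair[OF meeting] by metis
  from directions show ?thesis
  proof (elim disjE conjE)
    assume "is_V pos (pivot P) a" "is_H pos (pivot P) b"
    then show ?thesis
      using signed_weight_swap_tails_vertical_first[OF meeting st(3,1) split] by (simp add: Pair)
  next
    assume "is_H pos (pivot P) a" "is_V pos (pivot P) b"
    have swap: "swap_tails z = (\<sigma> \<circ> crossing_swap P, exchange_tails P)"
      by (simp add: Pair swap_tails_def)
    note pivot = pivot_exchange_tails[OF meeting]
    have "signed_weight (swap_tails (swap_tails z)) = - signed_weight (swap_tails z)"
      unfolding swap
    proof (rule signed_weight_swap_tails_vertical_first)
      show "(\<sigma> \<circ> crossing_swap P, exchange_tails P) \<in> intersecting"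
        using swap_tails_in_intersecting[OF assms] by (simp add: swap)
      show "crossing (exchange_tails P) = {s, t}" "s < t"
        using crossing_exchange_tails[OF meeting] st by simp_all
      show "exchange_tails P ! s = as @ pivot (exchange_tails P) # b # B"
        "exchange_tails P ! t = bs @ pivot (exchange_tails P) # a # A"
        using nth_exchange_crossing[OF meeting st(3,1) split] by (simp_all add: pivot)
      show "is_V pos (pivot (exchange_tails P)) b" "is_H pos (pivot (exchange_tails P)) a"
        unfolding pivot by fact+
    qed
    then show ?thesis by (simp add: swap_tails_involution[OF assms])
  qed
qed

lemma sum_intersecting: "sum signed_weight intersecting = 0"
  using signed_weight_swap_tails swap_tails_in_intersecting swap_tails_involution swap_tails_neq
  by (rule sum_involution_eq_0)

section \<open>Flows\<close>

lemma shared_empty_iff: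
  "shared P = {} \<longleftrightarrow> (\<forall>s<k. \<forall>t<k. s \<noteq> t \<longrightarrow> set (P ! s) \<inter> set (P ! t) = {})"
  by (auto simp: shared_def)

lemma sink_of_disjoint_routes:
  assumes routes: "\<And>t. t < k \<Longrightarrow> route (P ! t) (src t) (j t)" and "shared P = {}"
    and J: "\<And>t. t < k \<Longrightarrow> j t \<in> J" and "t < k"
  shows "j t = snk t"
proof -
  have "strict_mono_on {..<k} j"
    using assms(2) sinks_ordered_if_disjoint[OF routes routes]
      strict_mono_onD[OF strict_mono_on_src]
    by (auto simp: strict_mono_on_def shared_empty_iff)
  then have "map j [0..<card J] = sorted_list_of_set J"
    using J card_I_eq_J by (intro map_upt_eq_sorted_list_of_set finite_J) auto
  then show ?thesis using \<open>t < k\<close> card_I_eq_J by (metis add_0 diff_zero length_upt nth_map nth_upt)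
qed

lemma disjoint_system_id:
  assumes system: "(\<sigma>, P) \<in> all_systems" and "shared P = {}"
  shows "\<sigma> = id"
proof
  fix t
  show "\<sigma> t = id t"
  proof (cases "t < k")
    case True
    have "snk (\<sigma> t) = snk t"
      using sink_of_disjoint_routes[OF system_route[OF system] assms(2) _ True]
        snk_in system_perm_less[OF system] by blast
    then show ?thesis using snk_eq_iff system_perm_less[OF system] True by simp
  next
    case False
    then show ?thesis using permutes_not_in[OF system_permutes[OF system]] by simp
  qed
qed

lemma flows_eq: "flows E r c I J = {P \<in> systems id. shared P = {}}"
proof (intro set_eqI iffI)
  fix P assume "P \<in> flows E r c I J"
  then have len: "length P = k" and disjoint: "shared P = {}"
    and "\<forall>t<k. \<exists>j\<in>J. is_path E (P ! t) (r (src t)) (c j)"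
    by (auto simp: flows_def shared_empty_iff)
  then obtain j where j: "\<And>t. t < k \<Longrightarrow> j t \<in> J \<and> is_path E (P ! t) (r (src t)) (c (j t))" by metis
  then have routes: "route (P ! t) (src t) (j t)" if "t < k" for t
    using src_in[OF that] j[OF that] J_subset unfolding route_def by blast
  then have "j t = snk t" if "t < k" for t
    using sink_of_disjoint_routes[OF routes disjoint _ that] j by blast
  then show "P \<in> {P \<in> systems id. shared P = {}}"
    using routes len disjoint by (simp add: systems_iff)
next
  fix P assume "P \<in> {P \<in> systems id. shared P = {}}"
  then show "P \<in> flows E r c I J"
    using snk_in by (auto simp: systems_iff route_def flows_def shared_empty_iff)
qed

lemma sum_nonintersecting:
  "sum signed_weight (all_systems - intersecting) =
    (\<Sum>P\<in>flows E r c I J. flow_weight pos m r x xinv P)"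
proof -
  have "all_systems - intersecting = Pair id ` flows E r c I J"
    using disjoint_system_id permutes_id by (auto simp: flows_eq intersecting_def all_systems_def)
  then show ?thesis
    by (simp add: sum.reindex inj_on_def signed_weight_def flow_weight_def inversions_id emb_1)
qed

lemma qminor_path_matrix:
  "qminor emb q (path_matrix E pos m r c x xinv) I J =
    (\<Sum>P\<in>flows E r c I J. flow_weight pos m r x xinv P)"
proof -
  have "intersecting \<subseteq> all_systems" by (auto simp: intersecting_def)
  then have "sum signed_weight all_systems =
    sum signed_weight (all_systems - intersecting) + sum signed_weight intersecting"
    by (rule sum.subset_diff) (rule finite_all_systems)
  then show ?thesis by (simp add: qminor_eq_sum_all_systems sum_nonintersecting sum_intersecting)
qed

end

theorem theorem3p1:
  fixes V :: "'v set" and E :: "('v \<times> 'v) set" and pos :: "'v \<Rightarrow> real \<times> real"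
    and m n :: nat and r c :: "nat \<Rightarrow> 'v"
    and q :: "'k::field" and emb :: "'k \<Rightarrow> 'a::ring_1"
    and x xinv :: "'v \<Rightarrow> 'a"
    and I J :: "nat set"
  assumes G: "se_graph V E pos m n r c"
    and q: "q \<noteq> 0"
    \<comment> \<open>'a is a K-algebra via emb\<close>
    and emb_1: "emb 1 = 1"
    and emb_add: "\<And>a b. emb (a + b) = emb a + emb b"
    and emb_mult: "\<And>a b. emb (a * b) = emb a * emb b"
    and emb_central: "\<And>a z. emb a * z = z * emb a"
    \<comment> \<open>x w (w in W) are invertible and satisfy the defining relations of L_G\<close>
    and inv: "\<And>w. w \<in> inner_vertices V m n r c \<Longrightarrow> x w * xinv w = 1 \<and> xinv w * x w = 1"
    and relH: "\<And>u v. u \<in> inner_vertices V m n r c \<Longrightarrow> v \<in> inner_vertices V m n r c \<Longrightarrow>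
                 u \<noteq> v \<Longrightarrow> hpath E pos u v \<Longrightarrow> x u * x v = emb q * x v * x u"
    and relV: "\<And>u v. u \<in> inner_vertices V m n r c \<Longrightarrow> v \<in> inner_vertices V m n r c \<Longrightarrow>
                 u \<noteq> v \<Longrightarrow> vpath E pos u v \<Longrightarrow> x v * x u = emb q * x u * x v"
    and relC: "\<And>u v. u \<in> inner_vertices V m n r c \<Longrightarrow> v \<in> inner_vertices V m n r c \<Longrightarrow>
                 u \<noteq> v \<Longrightarrow> \<not> hpath E pos u v \<Longrightarrow> \<not> hpath E pos v u \<Longrightarrow>
                 \<not> vpath E pos u v \<Longrightarrow> \<not> vpath E pos v u \<Longrightarrow> x u * x v = x v * x u"
    and IJ: "I \<subseteq> {1..m}" "J \<subseteq> {1..n}" "card I = card J"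
  shows "qminor emb q (path_matrix E pos m r c x xinv) I J =
         (\<Sum>P\<in>flows E r c I J. flow_weight pos m r x xinv P)"
proof -
  interpret se_minor V E pos m n r c q emb x xinv I J
    by unfold_locales (fact G q emb_1 emb_add emb_mult emb_central inv relH relV relC IJ)+
  show ?thesis by (rule qminor_path_matrix)
qed

end
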